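(* Let $0<\mu\le L$ and $\sigma\in[0,1)$. Consider the DIGing algorithm $$x_i(k+1)=\sum_{j\in\mathcal N_i}w_{ij}x_j(k)-\alpha y_i(k),\qquad y_i(k+1)=\sum_{j\in\mathcal N_i}w_{ij}y_j(k)+\nabla f_i(x_i(k+1))-\nabla f_i(x_i(k)),$$ and the AugDGM algorithm $$x_i(k+1)=\sum_{j\in\mathcal N_i}w_{ij}\left[x_j(k)-\alpha y_j(k)\right],\qquad y_i(k+1)=\sum_{j\in\mathcal N_i}w_{ij}\left[y_j(k)+\nabla f_j(x_j(k+1))-\nabla f_j(x_j(k))\right],$$ $i=1,\dots,N$, both with $x_i(0)\in\mathbb R^d$ arbitrary and $y_i(0)=\nabla f_i(x_i(0))$, for the set of objective functions $\mathcal F_{\mu,L}$ over the graphs $\{\mathcal G\}_\sigma$. Let $\gamma_{DG}^*$ and $\gamma_{AD}^*$ be their respective optimal worst-case convergence rates. Then $\gamma_{AD}^{*}<\gamma_{DG}^{*}$.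
   Context: The problem is $\min_{x\in\mathbb R^d}\sum_{i=1}^N f_i(x)$ with $N\ge 2$ agents. Write $\boldsymbol x=(x_1,\dots,x_N)\in\mathbb R^{Nd}$ and $\boldsymbol f(\boldsymbol x)=\sum_{i=1}^N f_i(x_i)$. Function class: $\boldsymbol f\in\mathcal F_{\mu,L}$ means that each $f_i:\mathbb R^d\to\mathbb R$ is differentiable, $\mu$-strongly convex and $L$-smooth, i.e. for all $x,y\in\mathbb R^d$: $f_i(x)+\nabla f_i(x)^T(y-x)+\frac{\mu}{2}\|y-x\|^2\le f_i(y)\le f_i(x)+\nabla f_i(x)^T(y-x)+\frac L2\|y-x\|^2$. Graph class: a graph $\mathcal G$ is an undirected graph on $N$ nodes with adjacency (weight) matrix $W=(w_{ij})\in\mathbb R^{N\times N}$, where $w_{ij}>0$ if $j\in\mathcal N_i$ (the neighbour set of $i$) and $w_{ij}=0$ otherwise, such that $W=W^T$, $W\mathbf 1=\mathbf 1$, and $\|W\|_s:=\rho\left(W-\frac{\mathbf 1\mathbf 1^T}{N}\right)<1$ ($\rho$ = spectral radius). $\{\mathcal G\}_\sigma$ is the set of all such (connected) graphs with $\|W\|_s\le\sigma$. Worst-case rate: an algorithm with step size $\alpha$ is said to converge at the worst-case convergence rate $\gamma$ if $\lim_{k\to\infty}r^{-k}(\boldsymbol x(k)-\boldsymbol x^* )=\mathbf 0$ for all $r\in(\gamma,1]$, for every $\boldsymbol f\in\mathcal F_{\mu,L}$ and every $\mathcal G\in\{\mathcal G\}_\sigma$ (and every initialization as specified), where $\boldsymbol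 x^*=\mathbf 1_N\otimes x^*$ is the stationary point, $x^*$ being the minimizer of $\sum_i f_i$. $\gamma(\alpha)$ denotes the smallest $\gamma\in[0,1)$ with this property (and $\gamma(\alpha)$ is not less than $1$ if there is none). The optimal worst-case convergence rate is $\min_{\alpha>0}\gamma(\alpha)$. With $\varrho=\mu/L$, the paper establishes the formulas $\gamma_{DG}^{*}=\frac{\sigma\varrho+\sqrt{1+\varrho-\sigma^2\varrho}}{1+\varrho}$; and $\gamma_{AD}^{*}=\frac{L-\mu}{L+\mu}$ if $0\le\sigma\le\frac{1-\varrho}{3+\varrho}$, $\gamma_{AD}^{*}=\frac{\sigma\varrho+\sigma\sqrt{\varrho+\sigma^2-\sigma^2\varrho}}{\sigma^2+\varrho}$ if $\frac{1-\varrho}{3+\varrho}\le\sigma<1$. *)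

theory Defs
  imports "HOL-Analysis.Analysis"
begin

section \<open>Objective functions\<close>

definition grad :: "('a::real_inner \<Rightarrow> real) \<Rightarrow> 'a \<Rightarrow> 'a" where
  "grad g x = (THE D. GDERIV g x :> D)"

text \<open>The agents are the elements of the finite type \<open>'n\<close>, and \<open>f i\<close> is the local objective of
  agent \<open>i\<close>.\<close>

definition objectives :: "real \<Rightarrow> real \<Rightarrow> ('n::finite \<Rightarrow> real^'d \<Rightarrow> real) set" where
  "objectives \<mu> L = {f. \<forall>i. (\<forall>x. f i differentiable (at x)) \<and>
     (\<forall>x y. f i x + grad (f i) x \<bullet> (y - x) + \<mu> / 2 * (norm (y - x))\<^sup>2 \<le> f i y \<and>
            f i y \<le> f i x + grad (f i) x \<bullet> (y - x) + L / 2 * (norm (y - x))\<^sup>2)}"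

section \<open>Graphs\<close>

definition spectrum :: "real^'n^'n \<Rightarrow> complex set" where
  "spectrum A = {z. \<exists>v::complex^'n. v \<noteq> 0 \<and> map_matrix complex_of_real A *v v = z *s v}"

definition spectral_radius :: "real^'n^'n \<Rightarrow> real" where
  "spectral_radius A = (SUP z\<in>spectrum A. cmod z)"

definition mixing_norm :: "real^'n^'n \<Rightarrow> real" where
  "mixing_norm W = spectral_radius (W - (\<chi> i j. 1 / real CARD('n)))"

text \<open>A graph is given by its neighbour sets \<open>nb i\<close> and its weight matrix \<open>W\<close>.  An agent may be
  its own neighbour; this is the case exactly if its diagonal weight is positive.\<close>

definition graphs :: "real \<Rightarrow> (('n::finite \<Rightarrow> 'n set) \<times> (real^'n^'n)) set" where
  "graphs \<sigma> = {(nb, W).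
     (\<forall>i j. j \<in> nb i \<longleftrightarrow> i \<in> nb j) \<and>
     (\<forall>i j. (i, j) \<in> {(a, b). b \<in> nb a}\<^sup>*) \<and>
     (\<forall>i j. if j \<in> nb i then W $ i $ j > 0 else W $ i $ j = 0) \<and>
     transpose W = W \<and> W *v (\<chi> i. 1) = (\<chi> i. 1) \<and> mixing_norm W < 1 \<and> mixing_norm W \<le> \<sigma>}"

section \<open>Algorithms\<close>

text \<open>An algorithm is the set of its runs: \<open>alg \<alpha> nb W f x y\<close> says that \<open>x\<close>, \<open>y\<close> are the
  sequences of iterates and of gradient trackers for step size \<open>\<alpha>\<close>, graph \<open>(nb, W)\<close> and
  objectives \<open>f\<close>.  The initial point \<open>x 0\<close> is not constrained.\<close>

type_synonym ('n, 'd) algorithm =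
  "real \<Rightarrow> ('n \<Rightarrow> 'n set) \<Rightarrow> real^'n^'n \<Rightarrow> ('n \<Rightarrow> real^'d \<Rightarrow> real) \<Rightarrow>
   (nat \<Rightarrow> real^'d^'n) \<Rightarrow> (nat \<Rightarrow> real^'d^'n) \<Rightarrow> bool"

definition DIGing :: "('n::finite, 'd::finite) algorithm" where
  "DIGing \<alpha> nb W f x y \<longleftrightarrow>
     (\<forall>i. y 0 $ i = grad (f i) (x 0 $ i)) \<and>
     (\<forall>k i. x (k+1) $ i = (\<Sum>j\<in>nb i. W $ i $ j *\<^sub>R x k $ j) - \<alpha> *\<^sub>R y k $ i) \<and>
     (\<forall>k i. y (k+1) $ i = (\<Sum>j\<in>nb i. W $ i $ j *\<^sub>R y k $ j)
                            + grad (f i) (x (k+1) $ i) - grad (f i) (x k $ i))"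

definition AugDGM :: "('n::finite, 'd::finite) algorithm" where
  "AugDGM \<alpha> nb W f x y \<longleftrightarrow>
     (\<forall>i. y 0 $ i = grad (f i) (x 0 $ i)) \<and>
     (\<forall>k i. x (k+1) $ i = (\<Sum>j\<in>nb i. W $ i $ j *\<^sub>R (x k $ j - \<alpha> *\<^sub>R y k $ j))) \<and>
     (\<forall>k i. y (k+1) $ i = (\<Sum>j\<in>nb i. W $ i $ j *\<^sub>R
                (y k $ j + grad (f j) (x (k+1) $ j) - grad (f j) (x k $ j))))"

section \<open>Worst-case convergence rates\<close>

definition converges_at_rate ::
    "('n::finite, 'd::finite) algorithm \<Rightarrow> real \<Rightarrow> real \<Rightarrow> real \<Rightarrow> real \<Rightarrow> real \<Rightarrow> bool" where
  "converges_at_rate alg \<mu> L \<sigma> \<alpha> \<gamma> \<longleftrightarrow>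
     (\<forall>f\<in>objectives \<mu> L. \<forall>(nb, W)\<in>graphs \<sigma>. \<forall>x y xs.
        alg \<alpha> nb W f x y \<longrightarrow> is_arg_min (\<lambda>z. \<Sum>i\<in>UNIV. f i z) (\<lambda>_. True) xs \<longrightarrow>
        (\<forall>r\<in>{\<gamma><..1}. (\<lambda>k. (1 / r ^ k) *\<^sub>R (x k - (\<chi> i. xs))) \<longlonglongrightarrow> 0))"

text \<open>If the algorithm has no worst-case rate below \<open>1\<close>, then its rate is set to \<open>1\<close>.\<close>

definition worst_case_rate ::
    "('n::finite, 'd::finite) algorithm \<Rightarrow> real \<Rightarrow> real \<Rightarrow> real \<Rightarrow> real \<Rightarrow> real" where
  "worst_case_rate alg \<mu> L \<sigma> \<alpha> =
     (if \<exists>\<gamma>\<in>{0..<1}. converges_at_rate alg \<mu> L \<sigma> \<alpha> \<gamma>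
      then (LEAST \<gamma>. \<gamma> \<in> {0..<1} \<and> converges_at_rate alg \<mu> L \<sigma> \<alpha> \<gamma>)
      else 1)"

text \<open>The infimum is the minimum over all positive step sizes whenever the latter exists.\<close>

definition optimal_rate ::
    "('n::finite, 'd::finite) algorithm \<Rightarrow> real \<Rightarrow> real \<Rightarrow> real \<Rightarrow> real" where
  "optimal_rate alg \<mu> L \<sigma> = (INF \<alpha>\<in>{0<..}. worst_case_rate alg \<mu> L \<sigma> \<alpha>)"

end

theory Submission
  imports Defs
begin

text \<open>
  Both algorithms have to fight two effects: the mean of the iterates converges slowly if the step
  size \<open>\<alpha>\<close> is small, and the disagreement between the agents decays slowly if \<open>\<alpha>\<close> is large.
  A single number separates the two optimal rates, namely the root \<open>g\<close> in \<open>(\<sigma>, 1)\<close> of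
  \<open>\<mu> (g - \<sigma>)\<^sup>2 = L (1 - g\<^sup>2)\<close>.

  DIGing is not faster than \<open>g\<close> for any \<open>\<alpha>\<close> (\<open>DIGing_rate_lower_bound\<close>).  Two quadratic examples
  show this.  With Hessian \<open>\<mu>\<close> and all agents in consensus, the factor per step is \<open>1 - \<alpha> \<mu>\<close>.
  With Hessian \<open>L\<close> and a disagreement along an eigenvector of \<open>W\<close> for \<open>-\<sigma>\<close>, the eigenvalues \<open>z\<close>
  of the iteration satisfy \<open>(z + \<sigma>)\<^sup>2 = \<alpha> L (1 - z)\<close>, and \<open>z = -\<gamma>\<close> is one of them
  if \<open>(\<gamma> - \<sigma>)\<^sup>2 = \<alpha> L (1 + \<gamma>)\<close>.  For \<open>\<alpha> = (1 - g) / \<mu>\<close> both examples give the rate \<open>g\<close>; a smaller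
  \<open>\<alpha>\<close> makes the first one slower, a larger \<open>\<alpha>\<close> the second one.

  AugDGM also mixes the increments of iterates and trackers, so in the second example the loop gain has an additional
  factor \<open>\<sigma>\<^sup>2 < 1\<close>.  That it also beats \<open>g\<close> for all objectives and graphs
  (\<open>AugDGM_converges_at_rate\<close>) is a small-gain argument with sums of squares with geometric weights.
  The gradients, after subtraction of the mid-slope \<open>(\<mu> + L) / 2\<close>, are a feedback of gain at most
  \<open>(L - \<mu>) / 2\<close> (\<open>gradient_sector_bound\<close>); the linear dynamics, split orthogonally into
  consensus and disagreement, has a gain below the inverse of it
  (\<open>coupled_recurrences_decay\<close>) if
  \<open>1 - \<alpha> \<mu> < \<gamma>\<close>, \<open>\<alpha> L - 1 < \<gamma>\<close> and \<open>\<sigma>\<^sup>2 \<alpha> L (1 + \<gamma>) < (\<gamma> - \<sigma>)\<^sup>2\<close>.  Near \<open>\<gamma> = g\<close> and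
  \<open>\<alpha> = (1 - g) / \<mu>\<close> there is room in the last two conditions, and this room pays for
  some \<open>\<gamma> < g\<close> (\<open>AugDGM_beats_critical_rate\<close>).
\<close>

section \<open>Worst-case rates as least elements\<close>

text \<open>The rate \<open>\<gamma>\<close> only makes a claim about the \<open>r > \<gamma>\<close>, and each of them is also above some
  \<open>\<gamma>' > \<gamma>\<close>.  So the rates of an algorithm form a closed set, and the \<open>LEAST\<close> in
  \<open>worst_case_rate\<close> is attained.\<close>

lemma converges_at_rate_closed:
  assumes "\<And>\<gamma>'. \<gamma> < \<gamma>' \<Longrightarrow> \<gamma>' < 1 \<Longrightarrow> converges_at_rate alg \<mu> L \<sigma> \<alpha> \<gamma>'"
    and "\<gamma> < 1"
  shows "converges_at_rate alg \<mu> L \<sigma> \<alpha> \<gamma>"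
  unfolding converges_at_rate_def
proof (clarify, goal_cases)
  case (1 f nb W x y xs r)
  define \<gamma>' where "\<gamma>' = (\<gamma> + r) / 2"
  have "\<gamma> < \<gamma>'" "\<gamma>' < 1" "r \<in> {\<gamma>'<..1}"
    using 1(5) assms(2) by (auto simp: \<gamma>'_def)
  then show ?case
    using assms(1)[of \<gamma>'] 1(1-4) unfolding converges_at_rate_def by blast
qed

lemma converges_at_rate_mono:
  assumes "converges_at_rate alg \<mu> L \<sigma> \<alpha> \<gamma>" "\<gamma> \<le> \<gamma>'"
  shows "converges_at_rate alg \<mu> L \<sigma> \<alpha> \<gamma>'"
  unfolding converges_at_rate_def
proof (clarify, goal_cases)
  case (1 f nb W x y xs r)
  then show ?case
    using assms unfolding converges_at_rate_def by fastforce
qed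

lemma worst_case_rate_is_least:
  assumes "\<gamma> \<in> {0..<1}" "converges_at_rate alg \<mu> L \<sigma> \<alpha> \<gamma>"
  shows "worst_case_rate alg \<mu> L \<sigma> \<alpha> \<in> {0..<1}"
    and "converges_at_rate alg \<mu> L \<sigma> \<alpha> (worst_case_rate alg \<mu> L \<sigma> \<alpha>)"
    and "worst_case_rate alg \<mu> L \<sigma> \<alpha> \<le> \<gamma>"
proof -
  define S where "S = {\<gamma>. \<gamma> \<in> {0..<1} \<and> converges_at_rate alg \<mu> L \<sigma> \<alpha> \<gamma>}"
  have S: "\<gamma> \<in> S" "bdd_below S"
    using assms by (auto simp: S_def intro: bdd_belowI[of _ 0])
  have lower: "Inf S \<le> s" if "s \<in> S" for s
    using that S(2) by (rule cInf_lower)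
  have "0 \<le> Inf S"
    using S(1) by (intro cInf_greatest) (auto simp: S_def)
  moreover have "Inf S < 1"
    using lower[OF S(1)] assms(1) by simp
  moreover have "converges_at_rate alg \<mu> L \<sigma> \<alpha> (Inf S)"
  proof (rule converges_at_rate_closed)
    fix \<gamma>' assume "Inf S < \<gamma>'"
    then obtain s where "s \<in> S" "s < \<gamma>'"
      using cInf_lessD[of S \<gamma>'] S(1) by blast
    then show "converges_at_rate alg \<mu> L \<sigma> \<alpha> \<gamma>'"
      using converges_at_rate_mono[of alg \<mu> L \<sigma> \<alpha> s \<gamma>'] by (simp add: S_def)
  qed fact
  ultimately have mem: "Inf S \<in> S"
    by (simp add: S_def)
  have "(LEAST \<gamma>. \<gamma> \<in> S) = Inf S"
    using mem lower by (rule Least_equality)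
  then have "worst_case_rate alg \<mu> L \<sigma> \<alpha> = Inf S"
    using assms by (auto simp: worst_case_rate_def S_def)
  then show "worst_case_rate alg \<mu> L \<sigma> \<alpha> \<in> {0..<1}"
    and "converges_at_rate alg \<mu> L \<sigma> \<alpha> (worst_case_rate alg \<mu> L \<sigma> \<alpha>)"
    and "worst_case_rate alg \<mu> L \<sigma> \<alpha> \<le> \<gamma>"
    using mem lower[OF S(1)] by (auto simp: S_def)
qed

lemma worst_case_rate_nonneg: "0 \<le> worst_case_rate alg \<mu> L \<sigma> \<alpha>"
proof (cases "\<exists>\<gamma>\<in>{0..<1}. converges_at_rate alg \<mu> L \<sigma> \<alpha> \<gamma>")
  case True
  then show ?thesis using worst_case_rate_is_least(1)[of _ alg \<mu> L \<sigma> \<alpha>] by auto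
qed (simp add: worst_case_rate_def)

lemma worst_case_rate_lower_bound:
  assumes "\<And>\<gamma>. 0 \<le> \<gamma> \<Longrightarrow> \<gamma> < g \<Longrightarrow> \<not> converges_at_rate alg \<mu> L \<sigma> \<alpha> \<gamma>" and "g \<le> 1"
  shows "g \<le> worst_case_rate alg \<mu> L \<sigma> \<alpha>"
proof (cases "\<exists>\<gamma>\<in>{0..<1}. converges_at_rate alg \<mu> L \<sigma> \<alpha> \<gamma>")
  case True
  then show ?thesis
    using worst_case_rate_is_least(1,2)[of _ alg \<mu> L \<sigma> \<alpha>] assms(1) by (meson atLeastLessThan_iff not_le)
next
  case False
  then have "worst_case_rate alg \<mu> L \<sigma> \<alpha> = 1"
    by (simp only: worst_case_rate_def if_False)
  then show ?thesis using assms(2) by simp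
qed

section \<open>A small-gain argument in weighted square sums\<close>

text \<open>The Euclidean norm of the sequence \<open>a k / \<gamma> ^ k\<close>, truncated to \<open>k < K\<close> so that it is finite before any decay
  is known.  Bounds that are uniform in \<open>K\<close> say that \<open>a k\<close> decays like \<open>\<gamma> ^ k\<close>.  Square sums, and
  not suprema, are needed because the sector condition couples consensus and disagreement by a
  sum of squares.\<close>

definition wnorm :: "real \<Rightarrow> nat \<Rightarrow> (nat \<Rightarrow> real) \<Rightarrow> real" where
  "wnorm \<gamma> K a = L2_set (\<lambda>k. a k / \<gamma> ^ k) {..<K}"

lemma wnorm_nonneg [simp]: "0 \<le> wnorm \<gamma> K a"
  by (simp add: wnorm_def)

lemma wnorm_mono:
  assumes "0 < \<gamma>" "\<And>k. 0 \<le> a k" "\<And>k. a k \<le> b k"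
  shows "wnorm \<gamma> K a \<le> wnorm \<gamma> K b"
  unfolding wnorm_def using assms by (intro L2_set_mono divide_right_mono) auto

lemma wnorm_add: "wnorm \<gamma> K (\<lambda>k. a k + b k) \<le> wnorm \<gamma> K a + wnorm \<gamma> K b"
  unfolding wnorm_def add_divide_distrib by (rule L2_set_triangle_ineq)

lemma wnorm_cmult: "0 \<le> c \<Longrightarrow> wnorm \<gamma> K (\<lambda>k. c * a k) = c * wnorm \<gamma> K a"
  unfolding wnorm_def by (simp add: L2_set_right_distrib)

lemma wnorm_mono_K: "K \<le> K' \<Longrightarrow> wnorm \<gamma> K a \<le> wnorm \<gamma> K' a"
  unfolding wnorm_def L2_set_def by (intro real_sqrt_le_mono sum_mono2) auto

lemma wnorm_power2: "(wnorm \<gamma> K a)\<^sup>2 = (\<Sum>k<K. (a k)\<^sup>2 / (\<gamma> ^ k)\<^sup>2)"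
  by (simp add: wnorm_def L2_set_def sum_nonneg power_divide)

lemma member_le_wnorm:
  assumes "0 < \<gamma>" "k < K"
  shows "a k \<le> \<gamma> ^ k * wnorm \<gamma> K a"
proof -
  have "a k / \<gamma> ^ k \<le> wnorm \<gamma> K a"
    unfolding wnorm_def using assms by (intro member_le_L2_set) auto
  then show ?thesis using assms by (simp add: field_simps)
qed

lemma wnorm_shift:
  assumes "0 < \<gamma>" "0 \<le> a 0"
  shows "\<gamma> * wnorm \<gamma> (Suc K) a \<le> \<gamma> * a 0 + wnorm \<gamma> K (\<lambda>k. a (Suc k))"
    and "wnorm \<gamma> K (\<lambda>k. a (Suc k)) \<le> \<gamma> * wnorm \<gamma> (Suc K) a"
proof -
  define T where "T = (\<Sum>k<K. (a (Suc k) / \<gamma> ^ Suc k)\<^sup>2)"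
  have T: "0 \<le> T" by (simp add: T_def sum_nonneg)
  have eq: "wnorm \<gamma> (Suc K) a = sqrt ((a 0)\<^sup>2 + T)"
    unfolding wnorm_def L2_set_def T_def by (subst sum.lessThan_Suc_shift) simp
  have "wnorm \<gamma> K (\<lambda>k. a (Suc k)) = L2_set (\<lambda>k. \<gamma> * (a (Suc k) / \<gamma> ^ Suc k)) {..<K}"
    unfolding wnorm_def using assms by (intro L2_set_cong) auto
  also have "\<dots> = \<gamma> * L2_set (\<lambda>k. a (Suc k) / \<gamma> ^ Suc k) {..<K}"
    using assms by (simp only: L2_set_right_distrib)
  also have "\<dots> = \<gamma> * sqrt T"
    by (simp add: L2_set_def T_def)
  finally have eq': "wnorm \<gamma> K (\<lambda>k. a (Suc k)) = \<gamma> * sqrt T" .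
  have "wnorm \<gamma> (Suc K) a \<le> a 0 + sqrt T"
    unfolding eq using sqrt_add_le_add_sqrt[of "(a 0)\<^sup>2" T] T assms by simp
  then have "\<gamma> * wnorm \<gamma> (Suc K) a \<le> \<gamma> * (a 0 + sqrt T)"
    using assms by (intro mult_left_mono) auto
  then show "\<gamma> * wnorm \<gamma> (Suc K) a \<le> \<gamma> * a 0 + wnorm \<gamma> K (\<lambda>k. a (Suc k))"
    by (simp add: eq' algebra_simps)
  show "wnorm \<gamma> K (\<lambda>k. a (Suc k)) \<le> \<gamma> * wnorm \<gamma> (Suc K) a"
    unfolding eq' eq using assms by simp
qed

text \<open>A shift in time costs a factor \<open>\<gamma>\<close> in this norm, so a first-order recurrence with coefficient
  \<open>p < \<gamma>\<close> is a filter of gain at most \<open>1 / (\<gamma> - p)\<close>.\<close>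

lemma wnorm_recurrence:
  assumes "0 < \<gamma>" "0 \<le> p" and "\<And>k. 0 \<le> a k" and "\<And>k. a (Suc k) \<le> p * a k + h k"
  shows "(\<gamma> - p) * wnorm \<gamma> (Suc K) a \<le> \<gamma> * a 0 + wnorm \<gamma> K h"
proof -
  have "\<gamma> * wnorm \<gamma> (Suc K) a \<le> \<gamma> * a 0 + wnorm \<gamma> K (\<lambda>k. a (Suc k))"
    using assms by (intro wnorm_shift)
  also have "wnorm \<gamma> K (\<lambda>k. a (Suc k)) \<le> wnorm \<gamma> K (\<lambda>k. p * a k + h k)"
    using assms by (intro wnorm_mono) auto
  also have "\<dots> \<le> p * wnorm \<gamma> K a + wnorm \<gamma> K h"
    using wnorm_add[of \<gamma> K "\<lambda>k. p * a k" h] assms by (simp add: wnorm_cmult)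
  also have "p * wnorm \<gamma> K a \<le> p * wnorm \<gamma> (Suc K) a"
    using assms by (intro mult_left_mono wnorm_mono_K) auto
  finally show ?thesis by (simp add: algebra_simps)
qed

text \<open>The small-gain principle for a pair of channels: two filters, each of gain at most
  \<open>1 / \<omega>\<close>, are closed by a feedback of gain \<open>d < \<omega>\<close> that acts on both channels jointly.\<close>

lemma small_gain_bound:
  fixes P A Q S :: real
  assumes "0 \<le> P" "0 \<le> A" "0 \<le> Q" "0 \<le> S" "0 \<le> d" "d < \<omega>"
    and "\<omega> * P \<le> B + Q" "\<omega> * A \<le> C + S"
    and "Q\<^sup>2 + S\<^sup>2 \<le> d\<^sup>2 * (P\<^sup>2 + A\<^sup>2)"
  shows "sqrt (P\<^sup>2 + A\<^sup>2) \<le> sqrt (B\<^sup>2 + C\<^sup>2) / (\<omega> - d)"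
proof -
  have "\<omega> * sqrt (P\<^sup>2 + A\<^sup>2) = sqrt ((\<omega> * P)\<^sup>2 + (\<omega> * A)\<^sup>2)"
    using assms by (simp add: power_mult_distrib flip: distrib_left add: real_sqrt_mult)
  also have "\<dots> \<le> sqrt ((B + Q)\<^sup>2 + (C + S)\<^sup>2)"
    using assms by (intro real_sqrt_le_mono add_mono power_mono) auto
  also have "\<dots> \<le> sqrt (B\<^sup>2 + C\<^sup>2) + sqrt (Q\<^sup>2 + S\<^sup>2)"
    by (rule real_sqrt_sum_squares_triangle_ineq)
  also have "sqrt (Q\<^sup>2 + S\<^sup>2) \<le> sqrt (d\<^sup>2 * (P\<^sup>2 + A\<^sup>2))"
    using assms by (intro real_sqrt_le_mono)
  also have "\<dots> = d * sqrt (P\<^sup>2 + A\<^sup>2)"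
    using assms by (simp add: real_sqrt_mult)
  finally show ?thesis
    using assms by (simp add: field_simps)
qed

text \<open>This is AugDGM seen through norms: \<open>p\<close> and \<open>a\<close> stand for the consensus and the disagreement
  part of the error, \<open>b\<close> and \<open>m\<close> for the disagreement of the trackers and of the gradients, and
  \<open>q\<close>, \<open>s\<close> for the two parts of the gradients after subtraction of the mid-slope \<open>c\<close>.
  From \<open>q\<close> to \<open>p\<close> the gain is at most \<open>\<alpha> / (\<gamma> - \<kappa>)\<close>.  From \<open>m\<close> to \<open>a\<close> there are two filters
  in a row, with gain at most \<open>\<sigma>\<^sup>2 \<alpha> (1 + \<gamma>) / (\<gamma> - \<sigma>)\<^sup>2\<close> together; if this is less than
  \<open>1 / (c + d)\<close>, then moving \<open>c * a\<close> to the other side leaves a gain below \<open>1 / d\<close> from \<open>s\<close>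
  to \<open>a\<close>.  Now the small-gain principle applies.\<close>

lemma coupled_recurrences_decay:
  fixes p q a b m s :: "nat \<Rightarrow> real"
  assumes nonneg: "\<And>k. 0 \<le> p k" "\<And>k. 0 \<le> q k" "\<And>k. 0 \<le> a k" "\<And>k. 0 \<le> b k"
      "\<And>k. 0 \<le> m k" "\<And>k. 0 \<le> s k"
    and params: "0 \<le> \<kappa>" "0 < \<alpha>" "0 \<le> \<sigma>" "0 \<le> c" "0 \<le> d" "\<kappa> + \<alpha> * d < \<gamma>" "\<sigma> < \<gamma>"
      "\<sigma>\<^sup>2 * \<alpha> * (1 + \<gamma>) * (c + d) < (\<gamma> - \<sigma>)\<^sup>2"
    and p: "\<And>k. p (Suc k) \<le> \<kappa> * p k + \<alpha> * q k"
    and a: "\<And>k. a (Suc k) \<le> \<sigma> * a k + \<sigma> * \<alpha> * b k"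
    and b: "\<And>k. b (Suc k) \<le> \<sigma> * b k + \<sigma> * (m (Suc k) + m k)"
    and m: "\<And>k. m k \<le> s k + c * a k"
    and sector: "\<And>k. (q k)\<^sup>2 + (s k)\<^sup>2 \<le> d\<^sup>2 * ((p k)\<^sup>2 + (a k)\<^sup>2)"
  shows "\<exists>C. \<forall>k. p k + a k \<le> C * \<gamma> ^ k"
proof -
  have \<gamma>: "0 < \<gamma>" using params by linarith
  have "\<kappa> < \<gamma>" using params by (smt (verit) mult_nonneg_nonneg)
  define \<tau> where "\<tau> = \<sigma>\<^sup>2 * \<alpha> * (1 + \<gamma>)"
  have \<tau>: "0 \<le> \<tau>" using params \<gamma> by (simp add: \<tau>_def)
  \<comment> \<open>A slightly larger loop gain than \<open>\<tau>\<close>, to divide by it even if \<open>\<sigma> = 0\<close>.\<close>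
  obtain \<tau>' where \<tau>': "0 < \<tau>'" "\<tau> \<le> \<tau>'" "\<tau>' * (c + d) < (\<gamma> - \<sigma>)\<^sup>2"
  proof -
    define \<epsilon> where "\<epsilon> = ((\<gamma> - \<sigma>)\<^sup>2 - \<tau> * (c + d)) / (c + d + 1)"
    have \<epsilon>: "0 < \<epsilon>" using params by (simp add: \<epsilon>_def \<tau>_def)
    have "\<epsilon> * (c + d) < \<epsilon> * (c + d + 1)" using \<epsilon> by simp
    also have "\<dots> = (\<gamma> - \<sigma>)\<^sup>2 - \<tau> * (c + d)" using params by (simp add: \<epsilon>_def)
    finally have "(\<tau> + \<epsilon>) * (c + d) < (\<gamma> - \<sigma>)\<^sup>2" by (simp add: distrib_right)
    then show ?thesis using that[of "\<tau> + \<epsilon>"] \<epsilon> \<tau> by simp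
  qed
  define \<omega>\<^sub>1 where "\<omega>\<^sub>1 = (\<gamma> - \<kappa>) / \<alpha>"
  define \<omega>\<^sub>2 where "\<omega>\<^sub>2 = (\<gamma> - \<sigma>)\<^sup>2 / \<tau>' - c"
  define \<omega> where "\<omega> = min \<omega>\<^sub>1 \<omega>\<^sub>2"
  have "d < \<omega>\<^sub>1" using params by (simp add: \<omega>\<^sub>1_def field_simps)
  moreover have "d < \<omega>\<^sub>2" using \<tau>' by (simp add: \<omega>\<^sub>2_def field_simps)
  ultimately have \<omega>: "d < \<omega>" by (simp add: \<omega>_def)
  define B where "B = \<gamma> * p 0 / \<alpha>"
  define C where "C = ((\<gamma> - \<sigma>) * \<gamma> * a 0 + \<sigma> * \<alpha> * \<gamma> * b 0) / \<tau>'"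
  define R where "R = sqrt (B\<^sup>2 + C\<^sup>2) / (\<omega> - d)"
  have R: "sqrt ((wnorm \<gamma> (Suc K) p)\<^sup>2 + (wnorm \<gamma> (Suc K) a)\<^sup>2) \<le> R" for K
  proof -
    define P where "P = wnorm \<gamma> (Suc K) p"
    define Q where "Q = wnorm \<gamma> (Suc K) q"
    define A where "A = wnorm \<gamma> (Suc K) a"
    define B' where "B' = wnorm \<gamma> (Suc K) b"
    define M where "M = wnorm \<gamma> (Suc K) m"
    define S where "S = wnorm \<gamma> (Suc K) s"
    note defs = P_def Q_def A_def B'_def M_def S_def
    have nn: "0 \<le> P" "0 \<le> Q" "0 \<le> A" "0 \<le> B'" "0 \<le> M" "0 \<le> S"
      by (simp_all add: defs)
    have "(\<gamma> - \<kappa>) * P \<le> \<gamma> * p 0 + wnorm \<gamma> K (\<lambda>k. \<alpha> * q k)"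
      unfolding P_def using \<gamma> params(1) nonneg(1) p by (rule wnorm_recurrence)
    also have "wnorm \<gamma> K (\<lambda>k. \<alpha> * q k) \<le> \<alpha> * Q"
      unfolding Q_def using params by (simp add: wnorm_cmult wnorm_mono_K)
    finally have "(\<gamma> - \<kappa>) * P / \<alpha> \<le> (\<gamma> * p 0 + \<alpha> * Q) / \<alpha>"
      using params by (intro divide_right_mono) auto
    then have "\<omega>\<^sub>1 * P \<le> B + Q"
      using params by (simp add: \<omega>\<^sub>1_def B_def add_divide_distrib)
    moreover have "\<omega> * P \<le> \<omega>\<^sub>1 * P"
      using nn by (intro mult_right_mono) (auto simp: \<omega>_def)
    ultimately have 1: "\<omega> * P \<le> B + Q" by simp
    have "(\<gamma> - \<sigma>) * A \<le> \<gamma> * a 0 + wnorm \<gamma> K (\<lambda>k. \<sigma> * \<alpha> * b k)"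
      unfolding A_def using \<gamma> params(3) nonneg(3) a by (rule wnorm_recurrence)
    also have "wnorm \<gamma> K (\<lambda>k. \<sigma> * \<alpha> * b k) \<le> \<sigma> * \<alpha> * B'"
      unfolding B'_def using params by (subst wnorm_cmult) (auto intro!: mult_left_mono wnorm_mono_K)
    finally have A1: "(\<gamma> - \<sigma>) * A \<le> \<gamma> * a 0 + \<sigma> * \<alpha> * B'" by simp
    have "(\<gamma> - \<sigma>) * B' \<le> \<gamma> * b 0 + wnorm \<gamma> K (\<lambda>k. \<sigma> * (m (Suc k) + m k))"
      unfolding B'_def using \<gamma> params(3) nonneg(4) b by (rule wnorm_recurrence)
    also have "wnorm \<gamma> K (\<lambda>k. \<sigma> * (m (Suc k) + m k))
        \<le> \<sigma> * (wnorm \<gamma> K (\<lambda>k. m (Suc k)) + wnorm \<gamma> K m)"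
      using params by (subst wnorm_cmult) (auto intro!: mult_left_mono wnorm_add)
    also have "\<dots> \<le> \<sigma> * (\<gamma> * M + M)"
      unfolding M_def using params \<gamma> nonneg(5)
      by (intro mult_left_mono add_mono wnorm_shift wnorm_mono_K) auto
    finally have B1: "(\<gamma> - \<sigma>) * B' \<le> \<gamma> * b 0 + \<sigma> * (\<gamma> * M + M)" by simp
    have M: "M \<le> S + c * A"
    proof -
      have "M \<le> wnorm \<gamma> (Suc K) (\<lambda>k. s k + c * a k)"
        unfolding M_def using \<gamma> nonneg(5) m by (rule wnorm_mono)
      also have "\<dots> \<le> S + wnorm \<gamma> (Suc K) (\<lambda>k. c * a k)"
        unfolding S_def by (rule wnorm_add)
      finally show ?thesis unfolding A_def using params(4) by (simp add: wnorm_cmult)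
    qed
    have "(\<gamma> - \<sigma>)\<^sup>2 * A = (\<gamma> - \<sigma>) * ((\<gamma> - \<sigma>) * A)" by (simp add: power2_eq_square)
    also have "\<dots> \<le> (\<gamma> - \<sigma>) * (\<gamma> * a 0 + \<sigma> * \<alpha> * B')"
      using A1 params by (intro mult_left_mono) auto
    also have "\<dots> = (\<gamma> - \<sigma>) * \<gamma> * a 0 + \<sigma> * \<alpha> * ((\<gamma> - \<sigma>) * B')"
      by (simp add: algebra_simps)
    also have "\<sigma> * \<alpha> * ((\<gamma> - \<sigma>) * B') \<le> \<sigma> * \<alpha> * (\<gamma> * b 0 + \<sigma> * (\<gamma> * M + M))"
      using B1 params by (intro mult_left_mono) auto
    also have "(\<gamma> - \<sigma>) * \<gamma> * a 0 + \<dots> = \<tau>' * C + \<tau> * M"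
    proof -
      have "\<tau>' * C = (\<gamma> - \<sigma>) * \<gamma> * a 0 + \<sigma> * \<alpha> * \<gamma> * b 0"
        using \<tau>' by (simp add: C_def)
      then show ?thesis by (simp add: \<tau>_def power2_eq_square algebra_simps)
    qed
    also have "\<tau> * M \<le> \<tau>' * (S + c * A)"
      using \<tau>' \<tau> M nn by (intro mult_mono) auto
    finally have "(\<gamma> - \<sigma>)\<^sup>2 * A \<le> \<tau>' * C + \<tau>' * (S + c * A)" by simp
    then have "\<omega>\<^sub>2 * A \<le> C + S"
      using \<tau>' by (simp add: \<omega>\<^sub>2_def field_simps)
    moreover have "\<omega> * A \<le> \<omega>\<^sub>2 * A"
      using nn by (intro mult_right_mono) (auto simp: \<omega>_def)
    ultimately have 2: "\<omega> * A \<le> C + S" by simp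
    have "Q\<^sup>2 + S\<^sup>2 = (\<Sum>k<Suc K. ((q k)\<^sup>2 + (s k)\<^sup>2) / (\<gamma> ^ k)\<^sup>2)"
      unfolding Q_def S_def wnorm_power2 by (simp add: sum.distrib add_divide_distrib)
    also have "\<dots> \<le> (\<Sum>k<Suc K. d\<^sup>2 * ((p k)\<^sup>2 + (a k)\<^sup>2) / (\<gamma> ^ k)\<^sup>2)"
      by (intro sum_mono divide_right_mono sector) auto
    also have "\<dots> = d\<^sup>2 * (P\<^sup>2 + A\<^sup>2)"
      unfolding P_def A_def wnorm_power2
      by (simp add: sum.distrib add_divide_distrib distrib_left sum_distrib_left)
    finally have 3: "Q\<^sup>2 + S\<^sup>2 \<le> d\<^sup>2 * (P\<^sup>2 + A\<^sup>2)" .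
    have "sqrt (P\<^sup>2 + A\<^sup>2) \<le> R"
      unfolding R_def by (rule small_gain_bound[OF nn(1,3,2,6) params(5) \<omega> 1 2 3])
    then show ?thesis by (simp add: P_def A_def)
  qed
  have "p k + a k \<le> (2 * R) * \<gamma> ^ k" for k
  proof -
    have "p k \<le> \<gamma> ^ k * wnorm \<gamma> (Suc k) p" "a k \<le> \<gamma> ^ k * wnorm \<gamma> (Suc k) a"
      using \<gamma> by (auto intro: member_le_wnorm)
    moreover have "wnorm \<gamma> (Suc k) p \<le> R" "wnorm \<gamma> (Suc k) a \<le> R"
      using R[of k] by (smt (verit) real_sqrt_sum_squares_ge1 real_sqrt_sum_squares_ge2)+
    ultimately have "p k \<le> \<gamma> ^ k * R" "a k \<le> \<gamma> ^ k * R"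
      using \<gamma> by (smt (verit) mult_left_mono zero_le_power)+
    then show ?thesis by (simp add: algebra_simps)
  qed
  then show ?thesis by blast
qed

section \<open>Spectral radius and Euclidean norm\<close>

text \<open>Needed for the supremum in \<open>spectral_radius\<close> to be an upper bound.\<close>

lemma bdd_above_spectrum: "bdd_above (cmod ` spectrum (A :: real^'n::finite^'n))"
proof -
  let ?A = "map_matrix complex_of_real A"
  have "linear (\<lambda>v. ?A *v v)"
    by (intro linearI) (simp_all add: matrix_vector_right_distrib, simp add: vec_eq_iff matrix_vector_mult_def scaleR_right.sum)
  then obtain B where B: "\<And>v. norm (?A *v v) \<le> B * norm v"
    using linear_bounded by blast
  show ?thesis
  proof (rule bdd_aboveI[of _ B], clarify)
    fix z assume "z \<in> spectrum A"
    then obtain v where v: "v \<noteq> 0" "?A *v v = z *s v"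
      by (auto simp: spectrum_def)
    have "norm (z *s v) = cmod z * norm v"
      by (simp add: norm_vec_def norm_mult L2_set_right_distrib)
    then have "cmod z * norm v \<le> B * norm v"
      using B[of v] v by simp
    then show "cmod z \<le> B" using v by simp
  qed
qed

lemma abs_eigenvalue_le_spectral_radius:
  fixes A :: "real^'n::finite^'n"
  assumes "A *v v = s *\<^sub>R v" "v \<noteq> 0"
  shows "\<bar>s\<bar> \<le> spectral_radius A"
proof -
  let ?v = "(\<chi> i. complex_of_real (v $ i)) :: complex^'n"
  have "map_matrix complex_of_real A *v ?v = of_real s *s ?v"
  proof (simp add: vec_eq_iff matrix_vector_mult_def, intro allI)
    fix i
    have "(\<Sum>j\<in>UNIV. A $ i $ j * v $ j) = s * v $ i"
      using assms(1) by (simp add: vec_eq_iff matrix_vector_mult_def)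
    then show "(\<Sum>j\<in>UNIV. complex_of_real (A $ i $ j) * of_real (v $ j)) = of_real s * of_real (v $ i)"
      by (simp flip: of_real_mult of_real_sum)
  qed
  moreover have "?v \<noteq> 0"
    using assms(2) by (auto simp: vec_eq_iff)
  ultimately have "of_real s \<in> spectrum A"
    unfolding spectrum_def by blast
  then have "cmod (of_real s) \<le> spectral_radius A"
    unfolding spectral_radius_def using bdd_above_spectrum by (intro cSUP_upper) auto
  then show ?thesis by simp
qed

text \<open>Let \<open>w\<close> be a unit vector at which the norm of \<open>B w\<close> is largest, with value \<open>s\<close>.  Then
  \<open>B (B w) = s\<^sup>2 w\<close>, so \<open>B w + s w\<close> is an eigenvector for \<open>s\<close>, unless it vanishes, and then \<open>w\<close>
  is an eigenvector for \<open>-s\<close>.\<close>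

lemma norm_symmetric_matrix_le_spectral_radius:
  fixes B :: "real^'n::finite^'n"
  assumes sym: "transpose B = B"
  shows "norm (B *v v) \<le> spectral_radius B * norm v"
proof -
  have adj: "(B *v x) \<bullet> y = x \<bullet> (B *v y)" for x y
    using dot_lmul_matrix[of x B y] sym by (metis vector_transpose_matrix)
  have "continuous_on (sphere 0 1) (\<lambda>x. norm (B *v x))"
    by (intro continuous_intros linear_continuous_on bounded_linearI' ) (auto simp: matrix_vector_right_distrib matrix_vector_mult_scaleR)
  moreover have "sphere (0 :: real^'n) 1 \<noteq> {}"
    using vector_choose_size[of 1] by (auto simp: sphere_def)
  ultimately obtain w where w: "norm w = 1" and max: "\<And>x. norm x = 1 \<Longrightarrow> norm (B *v x) \<le> norm (B *v w)"
    using continuous_attains_sup[of "sphere (0 :: real^'n) 1" "\<lambda>x. norm (B *v x)"] by auto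
  define s where "s = norm (B *v w)"
  have bound: "norm (B *v x) \<le> s * norm x" for x
  proof (cases "x = 0")
    case False
    have "norm (B *v (x /\<^sub>R norm x)) \<le> s"
      unfolding s_def using False by (intro max) simp
    then show ?thesis
      using False by (simp only: matrix_vector_mult_scaleR) (simp add: field_simps)
  qed simp
  have "s\<^sup>2 = w \<bullet> (B *v (B *v w))"
    by (simp add: s_def power2_norm_eq_inner adj)
  \<comment> \<open>Equality in the Cauchy-Schwarz inequality for \<open>w\<close> and \<open>B (B w)\<close>.\<close>
  moreover have "norm (B *v (B *v w)) \<le> s\<^sup>2"
    using bound[of "B *v w"] by (simp add: s_def power2_eq_square)
  then have "(norm (B *v (B *v w)))\<^sup>2 \<le> (s\<^sup>2)\<^sup>2"
    by (intro power_mono) auto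
  moreover have "w \<bullet> w = 1"
    using w by (simp add: norm_eq_1)
  ultimately have "(B *v (B *v w) - s\<^sup>2 *\<^sub>R w) \<bullet> (B *v (B *v w) - s\<^sup>2 *\<^sub>R w) \<le> 0"
    unfolding power2_norm_eq_inner inner_diff_left inner_diff_right
    by (simp add: inner_commute flip: power2_eq_square)
  then have sq: "B *v (B *v w) = s\<^sup>2 *\<^sub>R w"
    by (metis inner_gt_zero_iff not_le right_minus_eq)
  have "s \<le> spectral_radius B"
  proof (cases "B *v w + s *\<^sub>R w = 0")
    case True
    then have "B *v w = (- s) *\<^sub>R w"
      by (simp add: eq_neg_iff_add_eq_0)
    moreover have "w \<noteq> 0" using w by auto
    ultimately show ?thesis
      using abs_eigenvalue_le_spectral_radius[of B w "- s"] by simp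
  next
    case False
    have "B *v (B *v w + s *\<^sub>R w) = s *\<^sub>R (B *v w + s *\<^sub>R w)"
      by (simp add: matrix_vector_right_distrib matrix_vector_mult_scaleR sq power2_eq_square
          scaleR_add_right add.commute)
    then show ?thesis
      using abs_eigenvalue_le_spectral_radius[OF _ False] by fastforce
  qed
  then have "s * norm v \<le> spectral_radius B * norm v"
    by (intro mult_right_mono) auto
  with bound[of v] show ?thesis by simp
qed

section \<open>Averaging and disagreement\<close>

text \<open>States of the network are matrices with one row per agent, so that mixing by \<open>W\<close> is the
  product \<open>W ** X\<close>; this matrix replaces every row by the mean of all rows.\<close>

definition averaging :: "real^'n^'n" where
  "averaging = (\<chi> i j. 1 / real CARD('n))"

lemma matrix_mul_row:
  fixes A :: "real^'n::finite^'n" and X :: "real^'d^'n"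
  shows "(A ** X) $ i = (\<Sum>j\<in>UNIV. A $ i $ j *\<^sub>R X $ j)"
  by (simp add: vec_eq_iff matrix_matrix_mult_def)

lemma matrix_mul_scaleR_right:
  fixes A :: "real^'n::finite^'n" and X :: "real^'d^'n"
  shows "A ** (c *\<^sub>R X) = c *\<^sub>R (A ** X)"
  by (simp add: vec_eq_iff matrix_matrix_mult_def sum_distrib_left ac_simps)

lemma matrix_mul_diff_right:
  fixes A :: "real^'n::finite^'n" and X :: "real^'d^'n"
  shows "A ** (X - Y) = A ** X - A ** Y"
  by (simp add: vec_eq_iff matrix_matrix_mult_def sum_subtractf right_diff_distrib)

lemma matrix_mul_diff_left:
  fixes A :: "real^'n::finite^'n" and X :: "real^'d^'n"
  shows "(A - B) ** X = A ** X - B ** X"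
  by (simp add: vec_eq_iff matrix_matrix_mult_def sum_subtractf left_diff_distrib)

lemma norm_matrix_mul_le:
  fixes B :: "real^'n::finite^'n" and X :: "real^'d::finite^'n"
  assumes "0 \<le> s" "\<And>v. norm (B *v v) \<le> s * norm v"
  shows "norm (B ** X) \<le> s * norm X"
proof -
  have columns: "(norm Y)\<^sup>2 = (\<Sum>l\<in>UNIV. (norm (column l Y))\<^sup>2)" for Y :: "real^'d^'n"
    unfolding power2_norm_eq_inner inner_vec_def column_def
    by (simp add: inner_vec_def) (rule sum.swap)
  have "column l (B ** X) = B *v column l X" for l
    by (simp add: vec_eq_iff column_def matrix_vector_mult_def matrix_matrix_mult_def)
  then have "(norm (B ** X))\<^sup>2 = (\<Sum>l\<in>UNIV. (norm (B *v column l X))\<^sup>2)"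
    by (simp add: columns)
  also have "\<dots> \<le> (\<Sum>l\<in>UNIV. (s * norm (column l X))\<^sup>2)"
    by (intro sum_mono power_mono assms) auto
  also have "\<dots> = (s * norm X)\<^sup>2"
    by (simp add: columns power_mult_distrib sum_distrib_left)
  finally show ?thesis
    using assms(1) by (simp add: power2_le_iff_abs_le)
qed

lemma averaging_idem: "(averaging :: real^'n::finite^'n) ** averaging = averaging"
  by (simp add: vec_eq_iff matrix_matrix_mult_def averaging_def)

lemma averaging_row:
  fixes X :: "real^'d^'n::finite"
  shows "(averaging ** X) $ i = (1 / real CARD('n)) *\<^sub>R (\<Sum>j\<in>UNIV. X $ j)"
  by (simp add: matrix_mul_row averaging_def scaleR_right.sum)

lemma averaging_pythagoras:
  fixes X :: "real^'d::finite^'n::finite"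
  shows "(norm X)\<^sup>2 = (norm (averaging ** X))\<^sup>2 + (norm (X - averaging ** X))\<^sup>2"
proof -
  have self_adjoint: "(averaging ** X) \<bullet> Y = X \<bullet> (averaging ** Y)" for X Y :: "real^'d^'n"
    unfolding inner_vec_def[of _ Y] inner_vec_def[of X] averaging_row
    by (simp add: inner_sum_left inner_sum_right flip: sum_divide_distrib) (rule sum.swap)
  have "(averaging ** X) \<bullet> (X - averaging ** X) = 0"
    unfolding self_adjoint by (simp add: matrix_mul_diff_right matrix_mul_assoc averaging_idem)
  then have "orthogonal (averaging ** X) (X - averaging ** X)"
    by (simp add: orthogonal_def)
  from norm_add_Pythagorean[OF this] show ?thesis by simp
qed

lemma graphs_weights:
  fixes W :: "real^'n::finite^'n"
  assumes "(nb, W) \<in> graphs \<sigma>"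
  shows "(\<Sum>j\<in>nb i. W $ i $ j *\<^sub>R (X :: real^'d^'n) $ j) = (W ** X) $ i"
    and "averaging ** W = averaging" and "W ** averaging = averaging"
    and "norm ((W - averaging) *v v) \<le> \<sigma> * norm v"
proof -
  have sym: "transpose W = W" and one: "W *v (\<chi> i. 1) = (\<chi> i. 1)" and "mixing_norm W \<le> \<sigma>"
    and zero: "\<And>i j. j \<notin> nb i \<Longrightarrow> W $ i $ j = 0"
    using assms by (auto simp: graphs_def split: if_splits)
  show "(\<Sum>j\<in>nb i. W $ i $ j *\<^sub>R X $ j) = (W ** X) $ i"
    unfolding matrix_mul_row using zero by (intro sum.mono_neutral_left) auto
  have row: "(\<Sum>j\<in>UNIV. W $ i $ j) = 1" for i
    using one by (simp add: vec_eq_iff matrix_vector_mult_def)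
  then show "W ** averaging = averaging"
    by (simp add: vec_eq_iff matrix_matrix_mult_def averaging_def flip: sum_divide_distrib)
  have "W $ i $ j = W $ j $ i" for i j
    using sym by (metis transpose_def vec_lambda_beta)
  then have "(\<Sum>i\<in>UNIV. W $ i $ j) = 1" for j
    using row[of j] by simp
  then show "averaging ** W = averaging"
    by (simp add: vec_eq_iff matrix_matrix_mult_def averaging_def flip: sum_divide_distrib)
  have "transpose (W - averaging) = W - averaging"
    using sym by (simp add: transpose_def vec_eq_iff averaging_def)
  then have "norm ((W - averaging) *v v) \<le> mixing_norm W * norm v"
    unfolding mixing_norm_def averaging_def by (rule norm_symmetric_matrix_le_spectral_radius)
  also have "\<dots> \<le> \<sigma> * norm v"
    using \<open>mixing_norm W \<le> \<sigma>\<close> by (intro mult_right_mono) auto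
  finally show "norm ((W - averaging) *v v) \<le> \<sigma> * norm v" .
qed

section \<open>Gradients of the objectives\<close>

lemma grad_half_norm_square: "grad (\<lambda>x. q / 2 * (norm x)\<^sup>2) x = q *\<^sub>R (x :: 'a::real_inner)"
proof -
  have deriv: "GDERIV (\<lambda>x. q / 2 * (norm x)\<^sup>2) x :> q *\<^sub>R x"
    unfolding gderiv_def power2_norm_eq_inner
    by (auto intro!: derivative_eq_intros simp: inner_commute field_simps)
  show ?thesis unfolding grad_def
  proof (rule the_equality)
    fix D assume "GDERIV (\<lambda>x. q / 2 * (norm x)\<^sup>2) x :> D"
    then have "(\<lambda>h. h \<bullet> D) = (\<lambda>h. h \<bullet> (q *\<^sub>R x))"
      using deriv unfolding gderiv_def by (rule has_derivative_unique)
    then have "h \<bullet> D = h \<bullet> (q *\<^sub>R x)" for h by meson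
    then show "D = q *\<^sub>R x" by (metis vector_eq_ldot)
  qed fact
qed

lemma half_norm_square_objectives:
  assumes "\<mu> \<le> q" "q \<le> L"
  shows "(\<lambda>_ x. q / 2 * (norm x)\<^sup>2) \<in> objectives \<mu> L"
proof -
  have eq: "q / 2 * (norm y)\<^sup>2 = q / 2 * (norm x)\<^sup>2 + q *\<^sub>R x \<bullet> (y - x) + q / 2 * (norm (y - x))\<^sup>2"
    for x y :: "real^'d"
    by (simp add: power2_norm_eq_inner inner_diff_left inner_diff_right inner_commute field_simps)
  have bounds: "\<mu> / 2 * (norm z)\<^sup>2 \<le> q / 2 * (norm z)\<^sup>2" "q / 2 * (norm z)\<^sup>2 \<le> L / 2 * (norm z)\<^sup>2"
    for z :: "real^'d"
    using assms by (auto intro!: mult_right_mono)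
  have "(\<lambda>x. q / 2 * (norm x)\<^sup>2) differentiable at x" for x :: "real^'d"
    unfolding power2_norm_eq_inner differentiable_def by (auto intro!: derivative_eq_intros)
  moreover have "q / 2 * (norm x)\<^sup>2 + q *\<^sub>R x \<bullet> (y - x) + \<mu> / 2 * (norm (y - x))\<^sup>2 \<le> q / 2 * (norm y)\<^sup>2"
    and "q / 2 * (norm y)\<^sup>2 \<le> q / 2 * (norm x)\<^sup>2 + q *\<^sub>R x \<bullet> (y - x) + L / 2 * (norm (y - x))\<^sup>2"
    for x y :: "real^'d"
    unfolding eq[of y x] using bounds[of "y - x"] by simp_all
  ultimately show ?thesis
    by (simp only: objectives_def mem_Collect_eq grad_half_norm_square) blast
qed

text \<open>After subtraction of \<open>(\<mu> + L) / 2\<close> times the identity, the gradient of \<open>f i\<close> is Lipschitz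
  with constant \<open>(L - \<mu>) / 2\<close>.  In terms of \<open>D\<close>, the gradient difference of \<open>f i - \<mu> / 2 * (norm x)\<^sup>2\<close>, this is cocoercivity:
  \<open>D \<bullet> D \<le> (L - \<mu>) * (D \<bullet> e)\<close>.\<close>

lemma gradient_sector_bound:
  assumes "f \<in> objectives \<mu> L" "\<mu> \<le> L"
  shows "norm (grad (f i) x - grad (f i) y - ((\<mu> + L) / 2) *\<^sub>R (x - y)) \<le> (L - \<mu>) / 2 * norm (x - y)"
proof -
  define e where "e = x - y"
  define D where "D = grad (f i) x - grad (f i) y - \<mu> *\<^sub>R e"
  define M where "M = L - \<mu>"
  have gx: "grad (f i) x = grad (f i) y + D + \<mu> *\<^sub>R e" and x: "x = y + e"
    by (simp_all add: D_def e_def)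
  have lower: "f i a + grad (f i) a \<bullet> (z - a) + \<mu> / 2 * (norm (z - a))\<^sup>2 \<le> f i z"
    and upper: "f i z \<le> f i a + grad (f i) a \<bullet> (z - a) + L / 2 * (norm (z - a))\<^sup>2" for a z
    using assms(1) by (auto simp: objectives_def)
  \<comment> \<open>The lower bound from one point and the upper bound from the other, both taken at
    \<open>y + t *\<^sub>R D\<close>, then the same with \<open>x\<close> and \<open>y\<close> (hence the sign of \<open>D\<close>) exchanged.\<close>
  have key: "(2 * t - M * t\<^sup>2) * (D \<bullet> D) \<le> D \<bullet> e" for t
  proof -
    have 1: "f i x + grad (f i) x \<bullet> (y + t *\<^sub>R D - x) + \<mu> / 2 * (norm (y + t *\<^sub>R D - x))\<^sup>2
        \<le> f i y + grad (f i) y \<bullet> (t *\<^sub>R D) + L / 2 * (norm (t *\<^sub>R D))\<^sup>2"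
      using lower[of x "y + t *\<^sub>R D"] upper[of "y + t *\<^sub>R D" y] by simp
    have 2: "f i y + grad (f i) y \<bullet> (x - t *\<^sub>R D - y) + \<mu> / 2 * (norm (x - t *\<^sub>R D - y))\<^sup>2
        \<le> f i x - grad (f i) x \<bullet> (t *\<^sub>R D) + L / 2 * (norm (t *\<^sub>R D))\<^sup>2"
      using lower[of y "x - t *\<^sub>R D"] upper[of "x - t *\<^sub>R D" x] by simp
    have a: "y + t *\<^sub>R D - x = t *\<^sub>R D - e" "x - t *\<^sub>R D - y = e - t *\<^sub>R D"
      by (simp_all add: x)
    have sq: "(norm (t *\<^sub>R D - e))\<^sup>2 = t\<^sup>2 * (D \<bullet> D) - 2 * t * (D \<bullet> e) + e \<bullet> e"
      "(norm (e - t *\<^sub>R D))\<^sup>2 = t\<^sup>2 * (D \<bullet> D) - 2 * t * (D \<bullet> e) + e \<bullet> e"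
      "(norm (t *\<^sub>R D))\<^sup>2 = t\<^sup>2 * (D \<bullet> D)"
      unfolding power2_norm_eq_inner inner_diff_left inner_diff_right
      by (simp_all add: inner_commute power2_eq_square algebra_simps)
    have "(2 * t - M * t\<^sup>2) * (D \<bullet> D) - D \<bullet> e
       = (grad (f i) x \<bullet> (t *\<^sub>R D - e) + \<mu> / 2 * (t\<^sup>2 * (D \<bullet> D) - 2 * t * (D \<bullet> e) + e \<bullet> e)
          - grad (f i) y \<bullet> (t *\<^sub>R D) - L / 2 * (t\<^sup>2 * (D \<bullet> D)))
       + (grad (f i) y \<bullet> (e - t *\<^sub>R D) + \<mu> / 2 * (t\<^sup>2 * (D \<bullet> D) - 2 * t * (D \<bullet> e) + e \<bullet> e)
          + grad (f i) x \<bullet> (t *\<^sub>R D) - L / 2 * (t\<^sup>2 * (D \<bullet> D)))"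
      unfolding gx M_def
      by (simp add: inner_diff_left inner_diff_right inner_add_left inner_commute
          power2_eq_square algebra_simps)
    also have "\<dots> \<le> 0"
      using 1 2 unfolding a sq by linarith
    finally show ?thesis by simp
  qed
  have cocoercive: "D \<bullet> D \<le> M * (D \<bullet> e)"
  proof (cases "M = 0")
    case True
    have "D \<bullet> D = 0"
    proof (rule ccontr)
      assume "D \<bullet> D \<noteq> 0"
      then have "2 * (D \<bullet> e + 1) \<le> D \<bullet> e"
        using key[of "(D \<bullet> e + 1) / (D \<bullet> D)"] True by simp
      moreover have "0 \<le> D \<bullet> e"
        using key[of 0] by simp
      ultimately show False by argo
    qed
    then show ?thesis using True by simp
  next
    case False
    then have "0 < M" using assms(2) by (simp add: M_def)
    then show ?thesis using key[of "1 / M"] by (simp add: field_simps power2_eq_square)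
  qed
  have "(norm (D - (M / 2) *\<^sub>R e))\<^sup>2 = D \<bullet> D - M * (D \<bullet> e) + (M / 2)\<^sup>2 * (e \<bullet> e)"
    unfolding power2_norm_eq_inner inner_diff_left inner_diff_right
    by (simp add: inner_commute power2_eq_square)
  also have "\<dots> \<le> (M / 2)\<^sup>2 * (e \<bullet> e)"
    using cocoercive by simp
  also have "\<dots> = (M / 2 * norm e)\<^sup>2"
    by (simp only: power_mult_distrib power2_norm_eq_inner)
  finally have "(norm (D - (M / 2) *\<^sub>R e))\<^sup>2 \<le> (M / 2 * norm e)\<^sup>2" .
  moreover have "0 \<le> M / 2 * norm e"
    using assms(2) by (simp add: M_def)
  ultimately have "norm (D - (M / 2) *\<^sub>R e) \<le> M / 2 * norm e"
    by (rule power2_le_imp_le)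
  moreover have "D - (M / 2) *\<^sub>R e = grad (f i) x - grad (f i) y - ((\<mu> + L) / 2) *\<^sub>R e"
  proof -
    have "\<mu> *\<^sub>R e + (M / 2) *\<^sub>R e = ((\<mu> + L) / 2) *\<^sub>R e"
      by (simp add: M_def field_simps flip: scaleR_add_left)
    then show ?thesis by (simp add: D_def algebra_simps)
  qed
  ultimately show ?thesis by (simp add: M_def e_def)
qed

text \<open>Otherwise a gradient step of size \<open>1 / (N L)\<close> would decrease the sum.\<close>

lemma sum_grad_minimizer:
  fixes f :: "'n::finite \<Rightarrow> real^'d::finite \<Rightarrow> real"
  assumes "f \<in> objectives \<mu> L" "0 < L" "is_arg_min (\<lambda>z. \<Sum>i\<in>UNIV. f i z) (\<lambda>_. True) xs"
  shows "(\<Sum>i\<in>UNIV. grad (f i) xs) = 0"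
proof -
  define G where "G = (\<Sum>i\<in>UNIV. grad (f i) xs)"
  define N where "N = real CARD('n)"
  define h where "h = - (1 / (N * L)) *\<^sub>R G"
  have N: "0 < N" by (simp add: N_def)
  have "(\<Sum>i\<in>UNIV. f i xs) \<le> (\<Sum>i\<in>UNIV. f i (xs + h))"
    using assms(3) by (auto simp: is_arg_min_linorder)
  also have "\<dots> \<le> (\<Sum>i\<in>UNIV. f i xs + grad (f i) xs \<bullet> h + L / 2 * (norm h)\<^sup>2)"
  proof (rule sum_mono)
    fix i
    have "f i z \<le> f i a + grad (f i) a \<bullet> (z - a) + L / 2 * (norm (z - a))\<^sup>2" for a z
      using assms(1) by (auto simp: objectives_def)
    from this[of "xs + h" xs] show "f i (xs + h) \<le> f i xs + grad (f i) xs \<bullet> h + L / 2 * (norm h)\<^sup>2"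
      by simp
  qed
  finally have "(\<Sum>i\<in>UNIV. f i xs) \<le> (\<Sum>i\<in>UNIV. f i xs) + G \<bullet> h + N * (L / 2 * (norm h)\<^sup>2)"
    by (simp add: sum.distrib G_def N_def inner_sum_left)
  moreover have "G \<bullet> h + N * (L / 2 * (norm h)\<^sup>2) = - (1 / (2 * N * L)) * (G \<bullet> G)"
    using N assms(2) unfolding h_def power2_norm_eq_inner by (simp add: power2_eq_square field_simps)
  ultimately have "(1 / (2 * N * L)) * (G \<bullet> G) \<le> 0"
    by linarith
  then have "G \<bullet> G \<le> 0"
    using N assms(2) by (simp add: field_simps mult_le_0_iff)
  then have "G = 0"
    by (metis inner_gt_zero_iff not_le)
  then show ?thesis by (simp add: G_def)
qed

section \<open>Convergence of AugDGM\<close>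

text \<open>Split the error \<open>e\<close> into its mean \<open>J ** e\<close> and the disagreement \<open>D e\<close>.  The mean of the trackers
  is always the mean of the current gradients, so the mean of the iterates descends along
  the mean of the local gradients, whereas mixing contracts disagreement by \<open>\<sigma>\<close>.  The gradients couple the two parts, and
  the sector bound for them, summed over the agents, splits orthogonally.\<close>

lemma AugDGM_run_decay:
  fixes x y :: "nat \<Rightarrow> real^'d::finite^'n::finite"
  assumes pos: "0 < \<mu>" "\<mu> \<le> L" "0 \<le> \<sigma>" "0 < \<alpha>"
    and rate: "\<sigma> < \<gamma>" "1 - \<alpha> * \<mu> < \<gamma>" "\<alpha> * L - 1 < \<gamma>"
      "\<sigma>\<^sup>2 * \<alpha> * (1 + \<gamma>) * L < (\<gamma> - \<sigma>)\<^sup>2"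
    and f: "f \<in> objectives \<mu> L" and graph: "(nb, W) \<in> graphs \<sigma>"
    and run: "AugDGM \<alpha> nb W f x y"
    and minimizer: "is_arg_min (\<lambda>z. \<Sum>i\<in>UNIV. f i z) (\<lambda>_. True) xs"
  shows "\<exists>C. \<forall>k. norm (x k - (\<chi> i. xs)) \<le> C * \<gamma> ^ k"
proof -
  define J where "J = (averaging :: real^'n^'n)"
  define c where "c = (\<mu> + L) / 2"
  define d where "d = (L - \<mu>) / 2"
  define X where "X = (\<chi> i. xs :: real^'d^'n)"
  define G where "G k = (\<chi> i. grad (f i) (x k $ i))" for k
  define G' where "G' = (\<chi> i. grad (f i) xs)"
  define e where "e k = x k - X" for k
  define u where "u k = G k - G'" for k
  define v where "v k = u k - c *\<^sub>R e k" for k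
  define D where "D Z = Z - J ** Z" for Z :: "real^'d^'n"
  note distrib = matrix_add_ldistrib matrix_mul_diff_right matrix_mul_scaleR_right
  note W = graphs_weights[OF graph]
  have J: "J ** (W ** Z) = J ** Z" "W ** (J ** Z) = J ** Z" "J ** (J ** Z) = J ** Z"
    for Z :: "real^'d^'n"
    by (simp_all add: J_def matrix_mul_assoc W averaging_idem)
  have D_linear: "D (A + B) = D A + D B" "D (A - B) = D A - D B" "D (t *\<^sub>R A) = t *\<^sub>R D A"
    for A B t
    by (simp_all add: D_def distrib scaleR_right_diff_distrib)
  have D_W: "norm (D (W ** Z)) \<le> \<sigma> * norm (D Z)" for Z
  proof -
    have "D (W ** Z) = (W - averaging) ** D Z"
      using J by (simp add: D_def matrix_mul_diff_left distrib J_def)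
    then show ?thesis
      using norm_matrix_mul_le[OF pos(3) W(4)] by simp
  qed
  have pythagoras: "(norm Z)\<^sup>2 = (norm (J ** Z))\<^sup>2 + (norm (D Z))\<^sup>2" for Z
    unfolding J_def D_def by (rule averaging_pythagoras)
  have JX: "J ** X = X"
    by (simp add: J_def X_def vec_eq_iff averaging_row sum_constant_scaleR del: sum_constant)
  have WX: "W ** X = X"
    using J(2)[of X] JX by simp
  have JG': "J ** G' = 0"
    using sum_grad_minimizer[OF f _ minimizer] pos
    by (simp add: J_def G'_def vec_eq_iff averaging_row)
  have x_step: "x (Suc k) = W ** (x k - \<alpha> *\<^sub>R y k)" for k
    using run W(1)[of _ "x k - \<alpha> *\<^sub>R y k"] by (auto simp: AugDGM_def vec_eq_iff)
  have y_step: "y (Suc k) = W ** (y k + G (Suc k) - G k)" for k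
    using run W(1)[of _ "y k + G (Suc k) - G k"] by (auto simp: AugDGM_def vec_eq_iff G_def)
  have y_mean: "J ** y k = J ** u k" for k
  proof (induction k)
    case 0
    have "y 0 = G 0" using run by (simp add: AugDGM_def G_def vec_eq_iff)
    then show ?case by (simp add: u_def distrib JG')
  next
    case (Suc k)
    then show ?case by (simp add: y_step u_def distrib J JG')
  qed
  have e_step: "e (Suc k) = W ** (e k - \<alpha> *\<^sub>R y k)" for k
    by (simp add: e_def x_step distrib WX)
  have mean_step: "J ** e (Suc k) = (1 - \<alpha> * c) *\<^sub>R (J ** e k) - \<alpha> *\<^sub>R (J ** v k)" for k
    by (simp add: e_step J distrib y_mean v_def algebra_simps)
  define p where "p k = norm (J ** e k)" for k
  define q where "q k = norm (J ** v k)" for k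
  define a where "a k = norm (D (e k))" for k
  define b where "b k = norm (D (y k))" for k
  define m where "m k = norm (D (u k))" for k
  define s where "s k = norm (D (v k))" for k
  have "\<exists>C. \<forall>k. p k + a k \<le> C * \<gamma> ^ k"
  proof (rule coupled_recurrences_decay[where \<kappa> = "\<bar>1 - \<alpha> * c\<bar>" and c = c and d = d])
    show "p (Suc k) \<le> \<bar>1 - \<alpha> * c\<bar> * p k + \<alpha> * q k" for k
      unfolding p_def q_def mean_step using pos
      by (intro order_trans[OF norm_triangle_ineq4]) simp
    show "a (Suc k) \<le> \<sigma> * a k + \<sigma> * \<alpha> * b k" for k
    proof -
      have "a (Suc k) \<le> \<sigma> * norm (D (e k - \<alpha> *\<^sub>R y k))"
        unfolding a_def e_step by (rule D_W)
      also have "\<dots> \<le> \<sigma> * (a k + \<alpha> * b k)"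
        unfolding a_def b_def D_linear using pos
        by (intro mult_left_mono order_trans[OF norm_triangle_ineq4]) auto
      finally show ?thesis by (simp add: algebra_simps)
    qed
    show "b (Suc k) \<le> \<sigma> * b k + \<sigma> * (m (Suc k) + m k)" for k
    proof -
      have "y (Suc k) = W ** (y k + (u (Suc k) - u k))"
        by (simp add: y_step u_def algebra_simps)
      then have "b (Suc k) \<le> \<sigma> * norm (D (y k + (u (Suc k) - u k)))"
        unfolding b_def by (simp only: D_W)
      also have "\<dots> \<le> \<sigma> * (b k + (m (Suc k) + m k))"
        unfolding b_def m_def D_linear using pos
        by (intro mult_left_mono order_trans[OF norm_triangle_ineq] add_mono norm_triangle_ineq4) auto
      finally show ?thesis by (simp add: algebra_simps)
    qed
    show "m k \<le> s k + c * a k" for k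
    proof -
      have "u k = v k + c *\<^sub>R e k" by (simp add: v_def)
      then have "D (u k) = D (v k) + c *\<^sub>R D (e k)" by (simp add: D_linear)
      then show ?thesis
        unfolding m_def s_def a_def using pos norm_triangle_ineq[of "D (v k)" "c *\<^sub>R D (e k)"]
        by (simp add: c_def)
    qed
    show "(q k)\<^sup>2 + (s k)\<^sup>2 \<le> d\<^sup>2 * ((p k)\<^sup>2 + (a k)\<^sup>2)" for k
    proof -
      have "norm (v k $ i) \<le> d * norm (e k $ i)" for i
        using gradient_sector_bound[OF f pos(2), of i "x k $ i" xs]
        by (simp add: v_def u_def e_def G_def G'_def X_def c_def d_def)
      then have "(norm (v k))\<^sup>2 \<le> (d * norm (e k))\<^sup>2"
        unfolding norm_vec_def using pos
        by (subst L2_set_right_distrib) (auto simp: d_def intro!: power_mono L2_set_mono)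
      then show ?thesis
        by (simp add: power_mult_distrib pythagoras[of "v k"] pythagoras[of "e k"] p_def q_def a_def s_def)
    qed
    show "\<bar>1 - \<alpha> * c\<bar> + \<alpha> * d < \<gamma>"
      using rate by (simp add: c_def d_def abs_if algebra_simps add_divide_distrib diff_divide_distrib)
    show "\<sigma>\<^sup>2 * \<alpha> * (1 + \<gamma>) * (c + d) < (\<gamma> - \<sigma>)\<^sup>2"
      using rate by (simp add: c_def d_def add_divide_distrib diff_divide_distrib)
  qed (use pos rate in \<open>simp_all add: p_def q_def a_def b_def m_def s_def c_def d_def\<close>)
  then obtain C where C: "\<And>k. p k + a k \<le> C * \<gamma> ^ k" by blast
  have "norm (e k) \<le> C * \<gamma> ^ k" for k
    using C[of k] norm_triangle_ineq[of "J ** e k" "D (e k)"] by (simp add: p_def a_def D_def)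
  then show ?thesis
    by (auto simp: e_def X_def)
qed

lemma AugDGM_converges_at_rate:
  assumes "0 < \<mu>" "\<mu> \<le> L" "0 \<le> \<sigma>" "0 < \<alpha>"
    and "\<sigma> < \<gamma>" "1 - \<alpha> * \<mu> < \<gamma>" "\<alpha> * L - 1 < \<gamma>" "\<sigma>\<^sup>2 * \<alpha> * (1 + \<gamma>) * L < (\<gamma> - \<sigma>)\<^sup>2"
  shows "converges_at_rate (AugDGM :: ('n::finite, 'd::finite) algorithm) \<mu> L \<sigma> \<alpha> \<gamma>"
  unfolding converges_at_rate_def
proof (clarify, goal_cases)
  case (1 f nb W x y xs r)
  obtain C where C: "\<And>k. norm (x k - (\<chi> i. xs)) \<le> C * \<gamma> ^ k"
    using AugDGM_run_decay[OF assms 1(1-4)] by blast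
  have r: "0 < \<gamma>" "\<gamma> < r" using 1(5) assms by auto
  have "(\<lambda>k. C * (\<gamma> / r) ^ k) \<longlonglongrightarrow> C * 0"
    using r by (intro tendsto_mult_left LIMSEQ_power_zero) auto
  then have lim: "(\<lambda>k. C * (\<gamma> / r) ^ k) \<longlonglongrightarrow> 0"
    by simp
  have "norm ((1 / r ^ k) *\<^sub>R (x k - (\<chi> i. xs))) \<le> C * (\<gamma> / r) ^ k" for k
    using r C[of k] by (simp add: power_divide divide_right_mono)
  then have "\<forall>\<^sub>F k in sequentially. norm ((1 / r ^ k) *\<^sub>R (x k - (\<chi> i. xs))) \<le> C * (\<gamma> / r) ^ k"
    by (intro always_eventually allI)
  from this lim show ?case by (rule Lim_null_comparison)
qed

section \<open>Slow runs of DIGing\<close>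

text \<open>The mixture of complete averaging and of the swap of two agents \<open>a \<noteq> b\<close> with weights \<open>1 - \<sigma>\<close>
  and \<open>\<sigma>\<close>.  It realises the eigenvalue \<open>-\<sigma>\<close> with positive entries for any number of agents.\<close>

definition swap_weights :: "real \<Rightarrow> 'n \<Rightarrow> 'n \<Rightarrow> real^'n^'n" where
  "swap_weights \<sigma> a b = (\<chi> i j. (1 - \<sigma>) / real CARD('n) + \<sigma> * of_bool (j = Transposition.transpose a b i))"

lemma sum_swap:
  "(\<Sum>i\<in>(UNIV :: 'n::finite set). v (Transposition.transpose a b i)) = (\<Sum>i\<in>UNIV. v i)"
  by (rule sum.reindex_bij_betw) (simp add: involuntory_imp_bij)

text \<open>The components of an eigenvector for \<open>z \<noteq> 0\<close> sum to \<open>0\<close>; on such vectors the matrix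
  is \<open>\<sigma>\<close> times an involution, hence \<open>z\<^sup>2 = \<sigma>\<^sup>2\<close>.\<close>

lemma swap_weights_spectrum:
  fixes a b :: "'n::finite"
  assumes "0 \<le> \<sigma>" "z \<in> spectrum (swap_weights \<sigma> a b - (\<chi> i j. 1 / real CARD('n)))"
  shows "cmod z \<le> \<sigma>"
proof -
  define \<tau> where "\<tau> = Transposition.transpose a b"
  have \<tau>: "\<tau> (\<tau> i) = i" for i by (simp add: \<tau>_def)
  obtain v :: "complex^'n" where v: "v \<noteq> 0"
    and ev: "map_matrix complex_of_real (swap_weights \<sigma> a b - (\<chi> i j. 1 / real CARD('n))) *v v = z *s v"
    using assms(2) by (auto simp: spectrum_def)
  define S where "S = (\<Sum>j\<in>UNIV. v $ j)"
  have row: "of_real \<sigma> * (v $ \<tau> i - S / of_nat CARD('n)) = z * v $ i" for i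
  proof -
    have "z * v $ i = (\<Sum>j\<in>UNIV. of_real (- \<sigma> / real CARD('n) + \<sigma> * of_bool (j = \<tau> i)) * v $ j)"
      using arg_cong[OF ev, of "\<lambda>u. u $ i"]
      by (simp add: matrix_vector_mult_def swap_weights_def \<tau>_def diff_divide_distrib)
    also have "\<dots> = (\<Sum>j\<in>UNIV. - of_real \<sigma> / of_nat CARD('n) * v $ j + (if j = \<tau> i then of_real \<sigma> * v $ j else 0))"
      by (intro sum.cong) (auto simp: algebra_simps)
    also have "\<dots> = - of_real \<sigma> / of_nat CARD('n) * S + of_real \<sigma> * v $ \<tau> i"
      unfolding sum.distrib S_def sum_distrib_left[symmetric] by simp
    finally show ?thesis by (simp add: algebra_simps)
  qed
  have "z * S = (\<Sum>i\<in>UNIV. of_real \<sigma> * (v $ \<tau> i - S / of_nat CARD('n)))"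
    unfolding row by (simp add: S_def sum_distrib_left)
  also have "\<dots> = of_real \<sigma> * ((\<Sum>i\<in>UNIV. v $ \<tau> i) - S)"
    by (simp add: sum_distrib_left[symmetric] sum_subtractf)
  also have "(\<Sum>i\<in>UNIV. v $ \<tau> i) = S"
    unfolding S_def \<tau>_def by (rule sum_swap)
  finally have "z = 0 \<or> S = 0" by simp
  then show ?thesis
  proof
    assume "S = 0"
    obtain i where i: "v $ i \<noteq> 0" using v by (auto simp: vec_eq_iff)
    have "(of_real \<sigma>)\<^sup>2 * v $ i = of_real \<sigma> * (of_real \<sigma> * v $ \<tau> (\<tau> i))"
      by (simp add: power2_eq_square \<tau>)
    also have "\<dots> = z * (of_real \<sigma> * v $ \<tau> i)"
      using row[of "\<tau> i"] \<open>S = 0\<close> by simp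
    also have "\<dots> = z\<^sup>2 * v $ i"
      using row[of i] \<open>S = 0\<close> by (simp add: power2_eq_square)
    finally have "(of_real \<sigma>)\<^sup>2 = z\<^sup>2" using i by simp
    then have "cmod ((of_real \<sigma>)\<^sup>2) = cmod (z\<^sup>2)"
      by (rule arg_cong)
    then have "(cmod (of_real \<sigma>))\<^sup>2 = (cmod z)\<^sup>2"
      by (simp only: norm_power)
    then show ?thesis using assms(1) by simp
  qed (use assms in simp)
qed

lemma swap_weights_graph:
  assumes "0 \<le> \<sigma>" "\<sigma> < 1"
  shows "(\<lambda>_. UNIV, swap_weights \<sigma> a (b :: 'n::finite)) \<in> graphs \<sigma>"
proof -
  let ?W = "swap_weights \<sigma> a b" and ?\<tau> = "Transposition.transpose a b"
  let ?B = "?W - (\<chi> i j. 1 / real CARD('n))"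
  have pos: "?W $ i $ j > 0" for i j
    using assms by (simp add: swap_weights_def add_pos_nonneg)
  have "j = ?\<tau> i \<longleftrightarrow> i = ?\<tau> j" for i j
    by (metis transpose_involutory)
  then have sym: "transpose ?W = ?W"
    by (simp add: transpose_def swap_weights_def vec_eq_iff)
  have row: "(\<Sum>j\<in>UNIV. ?W $ i $ j) = 1" for i
    by (simp add: swap_weights_def sum.distrib sum_distrib_left[symmetric] of_bool_def)
  then have one: "?W *v (\<chi> i. 1) = (\<chi> i. 1)"
    by (simp add: vec_eq_iff matrix_vector_mult_def)
  have "map_matrix complex_of_real ?B *v (\<chi> i. 1) = 0 *s (\<chi> i. 1)"
  proof (simp add: vec_eq_iff matrix_vector_mult_def, intro allI)
    fix i
    have "(\<Sum>j\<in>UNIV. ?W $ i $ j - 1 / real CARD('n)) = 0"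
      using row[of i] by (simp add: sum_subtractf)
    then have "complex_of_real (\<Sum>j\<in>UNIV. ?W $ i $ j - 1 / real CARD('n)) = 0" by simp
    then show "(\<Sum>j\<in>UNIV. complex_of_real (?W $ i $ j) - 1 / of_nat CARD('n)) = 0" by simp
  qed
  then have "0 \<in> spectrum ?B"
    unfolding spectrum_def by (intro CollectI exI[of _ "\<chi> i. 1"]) (auto simp: vec_eq_iff)
  then have "mixing_norm ?W \<le> \<sigma>"
    unfolding mixing_norm_def spectral_radius_def
    by (intro cSUP_least) (auto intro: swap_weights_spectrum[OF assms(1)])
  with pos sym one assms(2) show ?thesis
    by (auto simp: graphs_def)
qed

lemma swap_weights_antisymmetric:
  fixes w :: "real^'d" and a b :: "'n::finite"
  defines "V \<equiv> (\<chi> i. (of_bool (i = a) - of_bool (i = b)) *\<^sub>R w)"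
  assumes "a \<noteq> b"
  shows "swap_weights \<sigma> a b ** V = (- \<sigma>) *\<^sub>R V"
proof -
  let ?\<tau> = "Transposition.transpose a b"
  have "(\<Sum>j\<in>UNIV. V $ j) = 0"
    by (simp add: V_def of_bool_def flip: scaleR_left.sum add: sum_subtractf)
  then have mean: "(\<Sum>j\<in>UNIV. c *\<^sub>R V $ j) = 0" for c
    by (simp flip: scaleR_right.sum)
  have "(swap_weights \<sigma> a b ** V) $ i = (- \<sigma>) *\<^sub>R V $ i" for i
  proof -
    have "(swap_weights \<sigma> a b ** V) $ i = (\<Sum>j\<in>UNIV. ((1 - \<sigma>) / real CARD('n)) *\<^sub>R V $ j
        + (if j = ?\<tau> i then \<sigma> *\<^sub>R V $ j else 0))"
      unfolding matrix_mul_row by (intro sum.cong) (auto simp: swap_weights_def scaleR_add_left)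
    also have "\<dots> = \<sigma> *\<^sub>R V $ ?\<tau> i"
      unfolding sum.distrib mean by simp
    also have "V $ ?\<tau> i = - V $ i"
      using assms(2) by (auto simp: V_def Transposition.transpose_def)
    finally show ?thesis by simp
  qed
  then show ?thesis by (simp add: vec_eq_iff)
qed

lemma half_norm_square_minimizer:
  assumes "0 < q"
  shows "is_arg_min (\<lambda>z. \<Sum>i\<in>(UNIV :: 'n::finite set). q / 2 * (norm (z :: real^'d))\<^sup>2) (\<lambda>_. True) 0"
  using assms by (simp add: is_arg_min_linorder)

lemma slow_quadratic_run:
  fixes x y :: "nat \<Rightarrow> real^'d::finite^'n::finite"
  assumes "0 < \<mu>" "\<mu> \<le> q" "q \<le> L" "(nb, W) \<in> graphs \<sigma>"
    and run: "alg \<alpha> nb W (\<lambda>_ z. q / 2 * (norm z)\<^sup>2) x y"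
    and slow: "\<And>k. c * g ^ k \<le> norm (x k)" and "0 < c" "0 \<le> \<gamma>" "\<gamma> < g" "g \<le> 1"
  shows "\<not> converges_at_rate alg \<mu> L \<sigma> \<alpha> \<gamma>"
proof
  assume "converges_at_rate alg \<mu> L \<sigma> \<alpha> \<gamma>"
  moreover have "(\<lambda>_ z. q / 2 * (norm z)\<^sup>2) \<in> objectives \<mu> L"
    using assms by (intro half_norm_square_objectives)
  moreover have "is_arg_min (\<lambda>z. \<Sum>i\<in>(UNIV :: 'n set). q / 2 * (norm (z :: real^'d))\<^sup>2) (\<lambda>_. True) 0"
    using assms by (intro half_norm_square_minimizer) simp
  moreover have "g \<in> {\<gamma><..1}" using assms by simp
  ultimately have "(\<lambda>k. (1 / g ^ k) *\<^sub>R (x k - (\<chi> i. 0))) \<longlonglongrightarrow> 0"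
    using assms(4) run unfolding converges_at_rate_def by blast
  then have "(\<lambda>k. norm ((1 / g ^ k) *\<^sub>R (x k - (\<chi> i. 0)))) \<longlonglongrightarrow> 0"
    by (rule tendsto_norm_zero)
  moreover have "c \<le> norm ((1 / g ^ k) *\<^sub>R (x k - (\<chi> i. 0)))" for k
    using slow[of k] assms by (simp add: field_simps flip: zero_vec_def)
  ultimately have "c \<le> 0"
    by (intro LIMSEQ_le_const) auto
  with \<open>0 < c\<close> show False by simp
qed

lemma DIGing_iff:
  assumes "(nb, W) \<in> graphs \<sigma>"
  shows "DIGing \<alpha> nb W (\<lambda>_ z. q / 2 * (norm z)\<^sup>2) x y \<longleftrightarrow>
    y 0 = q *\<^sub>R x 0 \<and> (\<forall>k. x (Suc k) = W ** x k - \<alpha> *\<^sub>R y k) \<and>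
    (\<forall>k. y (Suc k) = W ** y k + q *\<^sub>R (x (Suc k) - x k))"
  unfolding DIGing_def graphs_weights(1)[OF assms] grad_half_norm_square
  by (auto simp: vec_eq_iff[of "y _"] vec_eq_iff[of "x _"] scaleR_right_diff_distrib add_diff_eq)

text \<open>If all agents start at the same point and share the flattest objective, then DIGing is gradient
  descent with contraction factor \<open>1 - \<alpha> * \<mu>\<close>: a small step size is slow.\<close>

lemma DIGing_slow_consensus:
  assumes "0 < \<mu>" "\<mu> \<le> L" "0 \<le> \<sigma>" "\<sigma> < 1" "0 < g" "g \<le> 1" "g \<le> 1 - \<alpha> * \<mu>" "0 \<le> \<gamma>" "\<gamma> < g"
  shows "\<not> converges_at_rate (DIGing :: ('n::finite, 'd::finite) algorithm) \<mu> L \<sigma> \<alpha> \<gamma>"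
proof -
  define X :: "real^'d^'n" where "X = (\<chi> i. 1)"
  obtain W :: "real^'n^'n" where graph: "(\<lambda>_. UNIV, W) \<in> graphs \<sigma>"
    using swap_weights_graph[OF assms(3,4)] by blast
  have "averaging ** X = X"
    by (simp add: X_def vec_eq_iff averaging_row sum_constant_scaleR del: sum_constant)
  then have WX: "W ** X = X"
    using graphs_weights(3)[OF graph] by (metis matrix_mul_assoc)
  define x where "x k = (1 - \<alpha> * \<mu>) ^ k *\<^sub>R X" for k
  define y where "y k = \<mu> *\<^sub>R x k" for k
  have "DIGing \<alpha> (\<lambda>_. UNIV) W (\<lambda>_ z. \<mu> / 2 * (norm z)\<^sup>2) x y"
    unfolding DIGing_iff[OF graph]
    by (simp add: x_def y_def matrix_mul_scaleR_right WX algebra_simps)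
  moreover have "norm X * g ^ k \<le> norm (x k)" for k
    using assms by (simp add: x_def mult.commute mult_left_mono power_mono)
  moreover have "0 < norm X"
    by (simp add: X_def vec_eq_iff)
  ultimately show ?thesis
    using assms graph by (intro slow_quadratic_run[where c = "norm X"]) auto
qed

text \<open>Moduli of iterate and tracker (the latter divided by \<open>L\<close>) along the eigenvector for \<open>-\<sigma>\<close>, where
  \<open>s = \<alpha> * L\<close>.  The signs of both alternate, so the moduli satisfy a recurrence with nonnegative
  coefficients.\<close>

fun oscillation :: "real \<Rightarrow> real \<Rightarrow> nat \<Rightarrow> real \<times> real" where
  "oscillation \<sigma> s 0 = (1, 1)"
| "oscillation \<sigma> s (Suc k) =
     (let (p, q) = oscillation \<sigma> s k in (\<sigma> * p + s * q, (1 + \<sigma>) * p + (\<sigma> + s) * q))"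

text \<open>The vector \<open>(s, g - \<sigma>)\<close> is multiplied by at least \<open>g\<close> in each step, by the last assumption for the
  second component and exactly for the first one.  As the coefficients are nonnegative, the
  sequence stays above its multiple that lies below the start \<open>(1, 1)\<close>.\<close>

lemma oscillation_growth:
  assumes "0 \<le> \<sigma>" "\<sigma> < g" "0 < s" "(g - \<sigma>)\<^sup>2 \<le> s * (1 + g)"
  shows "s / (s + g - \<sigma>) * g ^ k \<le> fst (oscillation \<sigma> s k)
    \<and> (g - \<sigma>) / (s + g - \<sigma>) * g ^ k \<le> snd (oscillation \<sigma> s k)"
proof (induction k)
  case 0
  show ?case using assms by simp
next
  case (Suc k)
  obtain p q where pq: "oscillation \<sigma> s k = (p, q)" by fastforce
  define h where "h = g ^ k / (s + g - \<sigma>)"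
  have h: "0 \<le> h" using assms by (simp add: h_def)
  have IH: "s * h \<le> p" "(g - \<sigma>) * h \<le> q"
    using Suc by (simp_all add: pq h_def)
  have "s * h * g = \<sigma> * (s * h) + s * ((g - \<sigma>) * h)"
    by (simp add: algebra_simps)
  also have "\<dots> \<le> \<sigma> * p + s * q"
    using assms IH by (intro add_mono mult_left_mono) auto
  finally have 1: "s * h * g \<le> \<sigma> * p + s * q" .
  have "(g - \<sigma>) * h * g = h * ((g - \<sigma>)\<^sup>2 + \<sigma> * (g - \<sigma>))"
    by (simp add: algebra_simps power2_eq_square)
  also have "\<dots> \<le> h * (s * (1 + g) + \<sigma> * (g - \<sigma>))"
    using assms h by (intro mult_left_mono) auto
  also have "\<dots> = (1 + \<sigma>) * (s * h) + (\<sigma> + s) * ((g - \<sigma>) * h)"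
    by (simp add: algebra_simps)
  also have "\<dots> \<le> (1 + \<sigma>) * p + (\<sigma> + s) * q"
    using assms IH by (intro add_mono mult_left_mono) auto
  finally have 2: "(g - \<sigma>) * h * g \<le> (1 + \<sigma>) * p + (\<sigma> + s) * q" .
  show ?case
    using 1 2 by (simp add: pq h_def mult.commute mult.left_commute)
qed

text \<open>If two agents are displaced in opposite directions and all objectives are as steep as possible,
  then the swap makes the disagreement alternate in sign, and the tracker amplifies it: a large
  step size is slow or divergent.\<close>

lemma DIGing_slow_disagreement:
  assumes "CARD('n::finite) \<ge> 2" "0 < \<mu>" "\<mu> \<le> L" "0 \<le> \<sigma>" "\<sigma> < 1" "0 < \<alpha>"
    and "\<sigma> < g" "g \<le> 1" "(g - \<sigma>)\<^sup>2 \<le> \<alpha> * L * (1 + g)" "0 \<le> \<gamma>" "\<gamma> < g"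
  shows "\<not> converges_at_rate (DIGing :: ('n, 'd::finite) algorithm) \<mu> L \<sigma> \<alpha> \<gamma>"
proof -
  obtain a b :: 'n where "a \<noteq> b"
    using assms(1) card_le_Suc0_iff_eq[of "UNIV :: 'n set"] by fastforce
  define W where "W = swap_weights \<sigma> a b"
  define V :: "real^'d^'n" where "V = (\<chi> i. (of_bool (i = a) - of_bool (i = b)) *\<^sub>R 1)"
  have graph: "(\<lambda>_. UNIV, W) \<in> graphs \<sigma>"
    unfolding W_def using assms by (intro swap_weights_graph)
  have WV: "W ** V = (- \<sigma>) *\<^sub>R V"
    unfolding W_def V_def using \<open>a \<noteq> b\<close> by (rule swap_weights_antisymmetric)
  define s where "s = \<alpha> * L"
  have s: "0 < s" using assms by (simp add: s_def)
  define p where "p k = fst (oscillation \<sigma> s k)" for k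
  define q where "q k = snd (oscillation \<sigma> s k)" for k
  have pq: "p 0 = 1" "q 0 = 1" "p (Suc k) = \<sigma> * p k + s * q k"
    "q (Suc k) = (1 + \<sigma>) * p k + (\<sigma> + s) * q k" for k
    by (simp_all add: p_def q_def case_prod_beta Let_def)
  define x where "x k = ((-1) ^ k * p k) *\<^sub>R V" for k
  define y where "y k = ((-1) ^ k * L * q k) *\<^sub>R V" for k
  have "x (Suc k) = W ** x k - \<alpha> *\<^sub>R y k" for k
    by (simp add: x_def y_def matrix_mul_scaleR_right WV pq s_def algebra_simps flip: scaleR_add_left scaleR_left_diff_distrib)
  moreover have "y (Suc k) = W ** y k + L *\<^sub>R (x (Suc k) - x k)" for k
    by (simp add: x_def y_def matrix_mul_scaleR_right WV pq s_def algebra_simps flip: scaleR_add_left scaleR_left_diff_distrib)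
  ultimately have run: "DIGing \<alpha> (\<lambda>_. UNIV) W (\<lambda>_ z. L / 2 * (norm z)\<^sup>2) x y"
    unfolding DIGing_iff[OF graph] by (simp add: x_def y_def pq)
  define c where "c = s / (s + g - \<sigma>)"
  have growth: "c * g ^ k \<le> p k" for k
    using oscillation_growth[of \<sigma> g s k] assms s by (simp add: c_def p_def s_def)
  have slow: "c * norm V * g ^ k \<le> norm (x k)" for k
  proof -
    have "c * norm V * g ^ k \<le> p k * norm V"
      using mult_right_mono[OF growth[of k] norm_ge_zero[of V]] by (simp add: ac_simps)
    also have "\<dots> \<le> \<bar>p k\<bar> * norm V"
      by (intro mult_right_mono) auto
    also have "\<dots> = norm (x k)"
      by (simp add: x_def abs_mult)
    finally show ?thesis .
  qed
  have "V $ a \<noteq> 0"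
    using \<open>a \<noteq> b\<close> by (simp add: V_def)
  then have "0 < c * norm V"
    unfolding c_def using assms s by (intro mult_pos_pos divide_pos_pos) auto
  with slow run show ?thesis
    using assms graph by (intro slow_quadratic_run) auto
qed

text \<open>For \<open>\<alpha> * \<mu> \<le> 1 - g\<close> consensus is slow; for \<open>\<alpha> * \<mu> \<ge> 1 - g\<close> the assumption on \<open>g\<close> makes
  disagreement slow.\<close>

lemma DIGing_rate_lower_bound:
  assumes "CARD('n::finite) \<ge> 2" "0 < \<mu>" "\<mu> \<le> L" "0 \<le> \<sigma>" "\<sigma> < 1" "0 < \<alpha>"
    and "\<sigma> < g" "g \<le> 1" "\<mu> * (g - \<sigma>)\<^sup>2 \<le> L * (1 - g\<^sup>2)"
  shows "g \<le> worst_case_rate (DIGing :: ('n, 'd::finite) algorithm) \<mu> L \<sigma> \<alpha>"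
proof (rule worst_case_rate_lower_bound)
  fix \<gamma> :: real assume "0 \<le> \<gamma>" "\<gamma> < g"
  show "\<not> converges_at_rate (DIGing :: ('n, 'd) algorithm) \<mu> L \<sigma> \<alpha> \<gamma>"
  proof (cases "g \<le> 1 - \<alpha> * \<mu>")
    case True
    then show ?thesis
      using assms \<open>0 \<le> \<gamma>\<close> \<open>\<gamma> < g\<close> by (intro DIGing_slow_consensus[of _ _ _ g]) auto
  next
    case False
    have "\<mu> * (g - \<sigma>)\<^sup>2 \<le> (1 - g) * (L * (1 + g))"
      using assms(9) by (simp add: power2_eq_square algebra_simps)
    also have "\<dots> \<le> (\<alpha> * \<mu>) * (L * (1 + g))"
      using False assms by (intro mult_right_mono) auto
    finally have "\<mu> * (g - \<sigma>)\<^sup>2 \<le> \<mu> * (\<alpha> * L * (1 + g))"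
      by (simp add: ac_simps)
    then have "(g - \<sigma>)\<^sup>2 \<le> \<alpha> * L * (1 + g)"
      using assms by simp
    then show ?thesis
      using assms \<open>0 \<le> \<gamma>\<close> \<open>\<gamma> < g\<close> by (intro DIGing_slow_disagreement[of _ _ _ _ g]) auto
  qed
qed fact

section \<open>Comparison of the optimal rates\<close>

lemma critical_rate_exists:
  fixes \<mu> L \<sigma> :: real
  assumes "0 < \<mu>" "\<mu> \<le> L" "0 \<le> \<sigma>" "\<sigma> < 1"
  obtains g where "\<sigma> < g" "g < 1" "\<mu> * (g - \<sigma>)\<^sup>2 = L * (1 - g\<^sup>2)"
proof -
  define h where "h g = \<mu> * (g - \<sigma>)\<^sup>2 - L * (1 - g\<^sup>2)" for g
  have "\<sigma>\<^sup>2 < 1" using assms by (simp add: power_less_one_iff abs_square_less_1)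
  then have "h \<sigma> < 0" "0 < h 1"
    using assms by (simp_all add: h_def)
  moreover have "continuous_on {\<sigma>..1} h"
    unfolding h_def by (intro continuous_intros)
  ultimately obtain g where g: "\<sigma> \<le> g" "g \<le> 1" "h g = 0"
    using IVT'[of h \<sigma> 0 1] assms by auto
  with \<open>h \<sigma> < 0\<close> \<open>0 < h 1\<close> have "g \<noteq> \<sigma>" "g \<noteq> 1" by auto
  with g that[of g] show ?thesis by (simp add: h_def)
qed

text \<open>At rate \<open>g\<close> and step size \<open>(1 - g) / \<mu>\<close> the gain condition for disagreement reads
  \<open>\<sigma>\<^sup>2 (g - \<sigma>)\<^sup>2 < (g - \<sigma>)\<^sup>2\<close>, where the factor \<open>\<sigma>\<^sup>2\<close> is the effect of the additional mixing in
  AugDGM.  All conditions are strict except \<open>1 - \<alpha> * \<mu> < \<gamma>\<close>, which is an equality at this point.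
  It becomes strict for the rate \<open>g - t\<close> with step size \<open>(1 - g + 2 * t) / \<mu>\<close>, and small \<open>t > 0\<close>
  preserve the others.\<close>

lemma AugDGM_beats_critical_rate:
  assumes "0 < \<mu>" "\<mu> \<le> L" "0 \<le> \<sigma>" "\<sigma> < g" "g < 1" "\<mu> * (g - \<sigma>)\<^sup>2 = L * (1 - g\<^sup>2)"
  obtains \<alpha> where "0 < \<alpha>"
    and "worst_case_rate (AugDGM :: ('n::finite, 'd::finite) algorithm) \<mu> L \<sigma> \<alpha> < g"
proof -
  define \<alpha> where "\<alpha> t = (1 - g + 2 * t) / \<mu>" for t
  have cont: "((\<lambda>t. g - t) \<longlongrightarrow> g) (at_right 0)"
    "(\<alpha> \<longlongrightarrow> (1 - g) / \<mu>) (at_right 0)"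
    unfolding \<alpha>_def using assms by (auto intro!: tendsto_eq_intros)
  have step: "(1 - g) / \<mu> * L * (1 + g) = (g - \<sigma>)\<^sup>2"
  proof -
    have "(1 - g) / \<mu> * L * (1 + g) = L * (1 - g\<^sup>2) / \<mu>"
      by (simp add: power2_eq_square algebra_simps)
    also have "\<dots> = (g - \<sigma>)\<^sup>2" using assms by (simp flip: assms(6))
    finally show ?thesis .
  qed
  have "\<forall>\<^sub>F t in at_right 0. \<sigma> < g - t"
    using cont(1) assms by (intro order_tendstoD) auto
  moreover have "\<forall>\<^sub>F t in at_right 0. \<alpha> t * L - 1 - (g - t) < 0"
  proof (rule order_tendstoD)
    show "((\<lambda>t. \<alpha> t * L - 1 - (g - t)) \<longlongrightarrow> (1 - g) / \<mu> * L - 1 - g) (at_right 0)"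
      by (intro tendsto_intros cont)
    have "(g - \<sigma>)\<^sup>2 < (1 + g)\<^sup>2"
      using assms by (intro power_strict_mono) auto
    then have "(1 - g) / \<mu> * L * (1 + g) < (1 + g) * (1 + g)"
      unfolding step by (simp add: power2_eq_square)
    then show "(1 - g) / \<mu> * L - 1 - g < 0"
      using assms by (simp only: mult_less_cancel_right_pos)
  qed
  moreover have "\<forall>\<^sub>F t in at_right 0. \<sigma>\<^sup>2 * \<alpha> t * (1 + (g - t)) * L - (g - t - \<sigma>)\<^sup>2 < 0"
  proof (rule order_tendstoD)
    show "((\<lambda>t. \<sigma>\<^sup>2 * \<alpha> t * (1 + (g - t)) * L - (g - t - \<sigma>)\<^sup>2) \<longlongrightarrow>
        \<sigma>\<^sup>2 * ((1 - g) / \<mu>) * (1 + g) * L - (g - \<sigma>)\<^sup>2) (at_right 0)"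
      by (intro tendsto_intros cont)
    have "\<sigma>\<^sup>2 < 1" using assms by (simp add: abs_square_less_1)
    then have "\<sigma>\<^sup>2 * (g - \<sigma>)\<^sup>2 < (g - \<sigma>)\<^sup>2"
      using assms by simp
    moreover have "\<sigma>\<^sup>2 * ((1 - g) / \<mu>) * (1 + g) * L = \<sigma>\<^sup>2 * (g - \<sigma>)\<^sup>2"
      by (simp flip: step)
    ultimately show "\<sigma>\<^sup>2 * ((1 - g) / \<mu>) * (1 + g) * L - (g - \<sigma>)\<^sup>2 < 0"
      by simp
  qed
  ultimately have "\<forall>\<^sub>F t in at_right 0. 0 < t \<and> \<sigma> < g - t \<and> \<alpha> t * L - 1 - (g - t) < 0 \<and>
      \<sigma>\<^sup>2 * \<alpha> t * (1 + (g - t)) * L - (g - t - \<sigma>)\<^sup>2 < 0"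
    using eventually_at_right_less[of "0 :: real"] by eventually_elim auto
  then obtain t where t: "0 < t" "\<sigma> < g - t" "\<alpha> t * L - 1 - (g - t) < 0"
      "\<sigma>\<^sup>2 * \<alpha> t * (1 + (g - t)) * L - (g - t - \<sigma>)\<^sup>2 < 0"
    using eventually_happens'[of "at_right (0 :: real)"] by (auto simp: trivial_limit_at_right_real)
  have "\<alpha> t * \<mu> = 1 - g + 2 * t" "0 < \<alpha> t"
    using assms t by (simp_all add: \<alpha>_def)
  then have "converges_at_rate (AugDGM :: ('n, 'd) algorithm) \<mu> L \<sigma> (\<alpha> t) (g - t)"
    using assms t by (intro AugDGM_converges_at_rate) auto
  then have "worst_case_rate (AugDGM :: ('n, 'd) algorithm) \<mu> L \<sigma> (\<alpha> t) \<le> g - t"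
    using assms t by (intro worst_case_rate_is_least) auto
  then show ?thesis
    using that[of "\<alpha> t"] \<open>0 < \<alpha> t\<close> t by simp
qed

theorem corollary1:
  fixes \<mu> L \<sigma> :: real
  assumes "CARD('n::finite) \<ge> 2"
    and "0 < \<mu>" and "\<mu> \<le> L"
    and "0 \<le> \<sigma>" and "\<sigma> < 1"
  shows "optimal_rate (AugDGM :: ('n, 'd::finite) algorithm) \<mu> L \<sigma>
           < optimal_rate (DIGing :: ('n, 'd) algorithm) \<mu> L \<sigma>"
proof -
  obtain g where g: "\<sigma> < g" "g < 1" "\<mu> * (g - \<sigma>)\<^sup>2 = L * (1 - g\<^sup>2)"
    using critical_rate_exists assms by blast
  obtain \<alpha> where \<alpha>: "0 < \<alpha>"
    "worst_case_rate (AugDGM :: ('n, 'd) algorithm) \<mu> L \<sigma> \<alpha> < g"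
    using AugDGM_beats_critical_rate assms g by blast
  have "optimal_rate (AugDGM :: ('n, 'd) algorithm) \<mu> L \<sigma>
      \<le> worst_case_rate (AugDGM :: ('n, 'd) algorithm) \<mu> L \<sigma> \<alpha>"
    unfolding optimal_rate_def using \<alpha>(1)
    by (intro cINF_lower bdd_belowI2[where m = 0] worst_case_rate_nonneg) auto
  also have "\<dots> < g" by fact
  also have "g \<le> optimal_rate (DIGing :: ('n, 'd) algorithm) \<mu> L \<sigma>"
    unfolding optimal_rate_def using assms g
    by (intro cINF_greatest DIGing_rate_lower_bound) auto
  finally show ?thesis .
qed

end
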